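(* Let $E$ and $F$ be two nonzero Banach lattices. Then the following statements are equivalent: (1) Each positive almost Dunford-Pettis operator $T:E\rightarrow F$ is almost L-weakly compact. (2) The norm of $F$ is order continuous.
   Context: All Banach spaces and Banach lattices are real, and operators are continuous linear maps. An operator $T$ from a Banach lattice $E$ into a Banach space $Y$ is almost Dunford-Pettis if $\|T(x_n)\|\to 0$ for every disjoint weakly null sequence $(x_n)$ in $E$. A nonempty norm bounded subset $A$ of a Banach lattice $F$ is L-weakly compact if $\|y_n\|\to 0$ for every disjoint sequence $(y_n)$ contained in the solid hull $\{y\in F: |y|\le |a| \text{ for some } a\in A\}$ of $A$. An operator $T$ from a Banach space $X$ into a Banach lattice $F$ is almost L-weakly compact if $T$ maps relatively weakly compact subsets of $X$ onto L-weakly compact subsets of $F$. The norm of a Banach lattice $F$ is order continuous if $\|x_\alpha\|\downarrow 0$ for every net $(x_\alpha)$ in $F$ with $x_\alpha\downarrow 0$. *)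

theory Defs
  imports "HOL-Analysis.Analysis" "HOL-Library.Lattice_Algebras"
begin

(* Real Banach lattices. The modulus is \<bar>x\<bar> = sup x (- x), by lattice_ab_group_add_abs. *)
class banach_lattice = banach + ordered_real_vector + lattice_ab_group_add_abs +
  assumes norm_mono_abs: "\<bar>x\<bar> \<le> \<bar>y\<bar> \<Longrightarrow> norm x \<le> norm y"

definition disjoint_seq :: "(nat \<Rightarrow> 'a::banach_lattice) \<Rightarrow> bool" where
  "disjoint_seq x \<longleftrightarrow> (\<forall>m n. m \<noteq> n \<longrightarrow> inf \<bar>x m\<bar> \<bar>x n\<bar> = 0)"

definition solid_hull :: "'a::banach_lattice set \<Rightarrow> 'a set" where
  "solid_hull A = {y. \<exists>a\<in>A. \<bar>y\<bar> \<le> \<bar>a\<bar>}"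

definition weak_topology :: "'a::real_normed_vector topology" where
  "weak_topology = topology_generated_by
     {f -` U | (f :: 'a \<Rightarrow> real) U. bounded_linear f \<and> open U}"

definition weakly_null :: "(nat \<Rightarrow> 'a::real_normed_vector) \<Rightarrow> bool" where
  "weakly_null x \<longleftrightarrow> (\<forall>f :: 'a \<Rightarrow> real. bounded_linear f \<longrightarrow> (\<lambda>n. f (x n)) \<longlonglongrightarrow> 0)"

definition relatively_weakly_compact :: "'a::real_normed_vector set \<Rightarrow> bool" where
  "relatively_weakly_compact A \<longleftrightarrow> compactin weak_topology (weak_topology closure_of A)"

definition positive_operator ::
    "('e::banach_lattice \<Rightarrow> 'f::banach_lattice) \<Rightarrow> bool" where
  "positive_operator T \<longleftrightarrow> bounded_linear T \<and> (\<forall>x. 0 \<le> x \<longrightarrow> 0 \<le> T x)"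

definition almost_Dunford_Pettis ::
    "('e::banach_lattice \<Rightarrow> 'y::banach) \<Rightarrow> bool" where
  "almost_Dunford_Pettis T \<longleftrightarrow> bounded_linear T \<and>
     (\<forall>x. disjoint_seq x \<and> weakly_null x \<longrightarrow> (\<lambda>n. norm (T (x n))) \<longlonglongrightarrow> 0)"

definition L_weakly_compact :: "'f::banach_lattice set \<Rightarrow> bool" where
  "L_weakly_compact A \<longleftrightarrow> A \<noteq> {} \<and> bounded A \<and>
     (\<forall>y. disjoint_seq y \<and> range y \<subseteq> solid_hull A \<longrightarrow> (\<lambda>n. norm (y n)) \<longlonglongrightarrow> 0)"

(* The empty set is excluded because L-weakly compact sets are nonempty by definition;
   otherwise no operator at all would be almost L-weakly compact. *)
definition almost_L_weakly_compact ::
    "('x::banach \<Rightarrow> 'f::banach_lattice) \<Rightarrow> bool" where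
  "almost_L_weakly_compact T \<longleftrightarrow> bounded_linear T \<and>
     (\<forall>A. A \<noteq> {} \<and> relatively_weakly_compact A \<longrightarrow> L_weakly_compact (T ` A))"

(* r i j reads "i precedes j" in the index set I. *)
definition directed_index :: "'i set \<Rightarrow> ('i \<Rightarrow> 'i \<Rightarrow> bool) \<Rightarrow> bool" where
  "directed_index I r \<longleftrightarrow> I \<noteq> {} \<and> (\<forall>i\<in>I. r i i) \<and>
     (\<forall>i\<in>I. \<forall>j\<in>I. \<forall>k\<in>I. r i j \<and> r j k \<longrightarrow> r i k) \<and>
     (\<forall>i\<in>I. \<forall>j\<in>I. \<exists>k\<in>I. r i k \<and> r j k)"

(* The net x, indexed by (I, r), is decreasing with infimum l. *)
definition net_decreases_to ::
    "'i set \<Rightarrow> ('i \<Rightarrow> 'i \<Rightarrow> bool) \<Rightarrow> ('i \<Rightarrow> 'b::order) \<Rightarrow> 'b \<Rightarrow> bool" where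
  "net_decreases_to I r x l \<longleftrightarrow>
     (\<forall>i\<in>I. \<forall>j\<in>I. r i j \<longrightarrow> x j \<le> x i) \<and>
     (\<forall>i\<in>I. l \<le> x i) \<and> (\<forall>z. (\<forall>i\<in>I. z \<le> x i) \<longrightarrow> z \<le> l)"

(* A definition cannot quantify over all index types, so the index sets are taken inside 'f.
   This is no restriction: see order_continuous_norm_net below. *)
definition order_continuous_norm :: "'f::banach_lattice itself \<Rightarrow> bool" where
  "order_continuous_norm _ \<longleftrightarrow>
     (\<forall>(I :: 'f set) r (x :: 'f \<Rightarrow> 'f).
        directed_index I r \<and> net_decreases_to I r x 0 \<longrightarrow>
        net_decreases_to I r (\<lambda>i. norm (x i)) 0)"

lemma order_continuous_norm_net:
  fixes I :: "'i set" and x :: "'i \<Rightarrow> 'f::banach_lattice"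
  assumes oc: "order_continuous_norm TYPE('f)"
    and dir: "directed_index I r" and dec: "net_decreases_to I r x 0"
  shows "net_decreases_to I r (\<lambda>i. norm (x i)) 0"
proof -
  have "directed_index (x ` I) (\<lambda>a b. b \<le> a)"
    unfolding directed_index_def
  proof (intro conjI ballI impI)
    show "x ` I \<noteq> {}" using dir by (auto simp: directed_index_def)
    fix a b assume "a \<in> x ` I" "b \<in> x ` I"
    then obtain i j where ij: "i \<in> I" "j \<in> I" "a = x i" "b = x j" by blast
    then obtain k where "k \<in> I" "r i k" "r j k"
      using dir unfolding directed_index_def by blast
    with ij dec show "\<exists>c\<in>x ` I. c \<le> a \<and> c \<le> b"
      unfolding net_decreases_to_def by blast
  qed auto
  moreover have "net_decreases_to (x ` I) (\<lambda>a b. b \<le> a) (\<lambda>a. a) 0"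
    using dec by (auto simp: net_decreases_to_def)
  ultimately have "net_decreases_to (x ` I) (\<lambda>a b. b \<le> a) norm 0"
    using oc unfolding order_continuous_norm_def by blast
  with dec show ?thesis
    by (simp add: net_decreases_to_def)
qed

end

theory Submission
  imports Defs
begin

text \<open>
  The equivalence factors through a property of \<open>F\<close> that mentions no operator: every disjoint
  sequence lying in an order interval \<open>[0, u]\<close> of \<open>F\<close> converges to \<open>0\<close> in norm.

  This property is equivalent to order continuity of the norm. If the norm is order continuous,
  \<open>v\<close> is disjoint in \<open>[0, u]\<close> and \<open>s\<^sub>n\<close> are the partial sums of \<open>v\<close>, then the differences \<open>z - s\<^sub>n\<close>,
  with \<open>z\<close> ranging over the upper bounds of all the \<open>s\<^sub>n\<close>, decrease to \<open>0\<close>; they are therefore small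
  in norm and dominate the tail of \<open>v\<close> (\<open>order_continuous_norm_imp_disjoint_null\<close>). For the converse,
  a decreasing net with infimum \<open>0\<close> is norm convergent as soon as it is norm Cauchy, and it is Cauchy
  unless there are increments \<open>d\<^sub>n \<ge> 0\<close>, bounded away from \<open>0\<close>, all of whose partial sums stay below
  one element \<open>x\<close>. Cutting such increments at height \<open>\<delta> x\<close> leaves a sequence of which no \<open>N\<close> members
  have a nonzero infimum when \<open>N\<close> is large, and induction on \<open>N\<close> reduces it to disjoint sequences
  (\<open>order_continuous_normI\<close>).

  If all positive almost Dunford-Pettis operators are almost L-weakly compact, the property follows
  from the rank one operators \<open>x \<mapsto> \<phi>(x) u\<close> with \<open>\<phi>\<close> a positive functional: they map a suitable
  singleton onto \<open>{u}\<close>, whose L-weak compactness contains the property for \<open>[0, u]\<close>.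

  Conversely, let \<open>T\<close> be positive and almost Dunford-Pettis and let \<open>A\<close> be relatively weakly compact.
  A disjoint sequence in the solid hull of \<open>A\<close> is weakly null (\<open>disjoint_seq_weakly_null\<close>), so \<open>T\<close>
  maps it to a norm null sequence. By disjointification this upgrades to a uniform statement: for
  every \<open>\<epsilon>\<close> there is \<open>u \<ge> 0\<close> with \<open>T((\<bar>a\<bar> - u)\<^sup>+)\<close> of norm below \<open>\<epsilon>\<close> for all \<open>a \<in> A\<close>
  (\<open>approximate_order_bound\<close>). Hence, up to \<open>\<epsilon>\<close>, a disjoint sequence in the solid hull of \<open>T(A)\<close> lies
  in the order interval \<open>[- T u, T u]\<close>, where the property of \<open>F\<close> applies.

  The weak nullity of disjoint sequences needs linear functionals. They come from a Hahn-Banach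
  theorem for sublinear functionals, and the weak compactness enters through a gliding hump argument
  that works with weak cluster points of sequences.
\<close>

section \<open>Vector lattice preliminaries\<close>

lemma norm_abs: "norm \<bar>x\<bar> = norm (x :: 'a::banach_lattice)"
  by (simp add: antisym norm_mono_abs)

lemma norm_mono_nonneg:
  fixes a b :: "'a::banach_lattice"
  assumes "0 \<le> a" "a \<le> b"
  shows "norm a \<le> norm b"
  using assms by (intro norm_mono_abs) (simp add: order_trans[OF assms])

lemma pprt_le_abs: "pprt x \<le> \<bar>x :: 'a::banach_lattice\<bar>"
  by (simp add: pprt_def abs_ge_self)

lemma norm_pprt_le: "norm (pprt x) \<le> norm (x :: 'a::banach_lattice)"
  using norm_mono_nonneg[OF zero_le_pprt pprt_le_abs, of x] by (simp add: norm_abs)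

lemma le_pprt: "x \<le> pprt (x :: 'a::banach_lattice)"
  by (simp add: pprt_def)

lemma pprt_add_le: "pprt (x + y) \<le> pprt x + pprt (y :: 'a::banach_lattice)"
  unfolding pprt_def[of "x + y"]
  by (intro sup_least add_mono le_pprt add_nonneg_nonneg zero_le_pprt)

lemma pprt_scaleR:
  fixes x :: "'a::banach_lattice"
  assumes "0 \<le> c"
  shows "pprt (c *\<^sub>R x) = c *\<^sub>R pprt x"
proof (cases "c = 0")
  case False
  have le: "pprt (c *\<^sub>R x) \<le> c *\<^sub>R pprt x" if "0 \<le> c" for c :: real and x :: 'a
    unfolding pprt_def[of "c *\<^sub>R x"] using that
    by (intro sup_least scaleR_left_mono le_pprt scaleR_nonneg_nonneg zero_le_pprt)
  have "c *\<^sub>R pprt x = c *\<^sub>R pprt (inverse c *\<^sub>R (c *\<^sub>R x))" using False by simp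
  also have "\<dots> \<le> c *\<^sub>R (inverse c *\<^sub>R pprt (c *\<^sub>R x))"
    using assms by (intro scaleR_left_mono le) simp_all
  also have "\<dots> = pprt (c *\<^sub>R x)" using False by simp
  finally show ?thesis using le[OF assms] by (simp add: antisym)
qed simp

lemma abs_scaleR_lattice:
  fixes x :: "'a::banach_lattice"
  shows "\<bar>c *\<^sub>R x\<bar> = \<bar>c\<bar> *\<^sub>R \<bar>x\<bar>"
proof -
  have nn: "\<bar>c *\<^sub>R x\<bar> = c *\<^sub>R \<bar>x\<bar>" if "0 \<le> c" for c
  proof -
    have "\<bar>c *\<^sub>R x\<bar> = pprt (c *\<^sub>R x) + pprt (c *\<^sub>R (- x))"
      by (simp add: abs_prts pprt_neg)
    also have "\<dots> = c *\<^sub>R (pprt x + pprt (- x))"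
      by (simp only: pprt_scaleR[OF that] scaleR_add_right)
    also have "\<dots> = c *\<^sub>R \<bar>x\<bar>" by (simp add: abs_prts pprt_neg)
    finally show ?thesis .
  qed
  show ?thesis
  proof (cases "0 \<le> c")
    case False
    then have "\<bar>(- c) *\<^sub>R x\<bar> = (- c) *\<^sub>R \<bar>x\<bar>" by (intro nn) simp
    with False show ?thesis by simp
  qed (simp add: nn)
qed

lemma abs_diff_le:
  fixes a b c :: "'a::banach_lattice"
  assumes "0 \<le> a" "0 \<le> b" "a \<le> c" "b \<le> c"
  shows "\<bar>a - b\<bar> \<le> c"
proof (rule abs_leI)
  show "a - b \<le> c" using add_mono[OF assms(3,2)] by (simp add: diff_le_eq)
  show "- (a - b) \<le> c" using add_mono[OF assms(4,1)] by (simp add: diff_le_eq)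
qed

lemma inf_add_le:
  fixes a b c :: "'a::banach_lattice"
  assumes "0 \<le> a" "0 \<le> b" "0 \<le> c"
  shows "inf a (b + c) \<le> inf a b + inf a c"
proof -
  have "inf a b + inf a c = inf (inf (a + a) (b + a)) (inf (a + c) (b + c))"
    by (simp add: add_sup_inf_distribs)
  moreover have "a \<le> a + a" "a \<le> b + a" "a \<le> a + c"
    using assms by simp_all
  ultimately show ?thesis
    by (simp add: le_infI1)
qed

lemma diff_inf_eq_pprt: "a - inf a b = pprt (a - (b :: 'a::banach_lattice))"
  by (simp add: pprt_def add_sup_distrib_left sup_commute)

lemma pprt_diff_add_inf: "pprt (a - b) + inf a b = (a :: 'a::banach_lattice)"
  by (simp only: diff_inf_eq_pprt[symmetric] diff_add_cancel)

lemma disjoint_mono: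
  fixes a b a' b' :: "'a::banach_lattice"
  assumes "inf a b = 0" "0 \<le> a'" "0 \<le> b'" "a' \<le> a" "b' \<le> b"
  shows "inf a' b' = 0"
  using assms inf_mono[of a' a b' b] by (simp add: antisym)

text \<open>Dividing by \<open>m = max 1 c\<close> brings both arguments of the infimum below \<open>a\<close> and \<open>b\<close>.\<close>

lemma inf_scaleR_le:
  fixes a b :: "'a::banach_lattice"
  assumes "0 \<le> a" "0 \<le> b"
  shows "inf a (c *\<^sub>R b) \<le> max 1 c *\<^sub>R inf a b"
proof -
  define m where "m = max 1 c"
  have m: "1 \<le> m" "c \<le> m" by (auto simp: m_def)
  have "inverse m *\<^sub>R inf a (c *\<^sub>R b) \<le> inf a b"
  proof (rule le_infI)
    have "inverse m *\<^sub>R inf a (c *\<^sub>R b) \<le> inverse m *\<^sub>R a"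
      using m by (intro scaleR_left_mono) auto
    also have "\<dots> \<le> 1 *\<^sub>R a" using m assms by (intro scaleR_right_mono) (auto simp: field_simps)
    finally show "inverse m *\<^sub>R inf a (c *\<^sub>R b) \<le> a" by simp
    have "inverse m *\<^sub>R inf a (c *\<^sub>R b) \<le> inverse m *\<^sub>R (c *\<^sub>R b)"
      using m by (intro scaleR_left_mono) auto
    also have "\<dots> = (inverse m * c) *\<^sub>R b" by simp
    also have "\<dots> \<le> 1 *\<^sub>R b" using m assms by (intro scaleR_right_mono) (auto simp: field_simps)
    finally show "inverse m *\<^sub>R inf a (c *\<^sub>R b) \<le> b" by simp
  qed
  then have "m *\<^sub>R (inverse m *\<^sub>R inf a (c *\<^sub>R b)) \<le> m *\<^sub>R inf a b"
    using m by (intro scaleR_left_mono) auto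
  then show ?thesis using m by (simp add: m_def)
qed

lemma disjoint_scaleR:
  fixes a b :: "'a::banach_lattice"
  assumes "inf a b = 0" "0 \<le> c"
  shows "inf a (c *\<^sub>R b) = 0"
proof -
  have ab: "0 \<le> a" "0 \<le> b" using assms(1) inf.cobounded1[of a b] inf.cobounded2[of a b] by simp_all
  then have "inf a (c *\<^sub>R b) \<le> 0" using inf_scaleR_le[of a b c] assms(1) by simp
  moreover have "0 \<le> inf a (c *\<^sub>R b)" using ab assms(2) by (auto intro: scaleR_nonneg_nonneg)
  ultimately show ?thesis by (rule antisym)
qed

lemma disjoint_sum:
  fixes v :: "'a::banach_lattice"
  assumes "finite S" "0 \<le> v" "\<And>i. i \<in> S \<Longrightarrow> 0 \<le> b i" "\<And>i. i \<in> S \<Longrightarrow> inf v (b i) = 0"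
  shows "inf v (\<Sum>i\<in>S. b i) = 0"
  using assms
proof (induction S rule: finite_induct)
  case empty
  then show ?case by (simp add: inf_absorb2)
next
  case (insert i S)
  have s: "0 \<le> (\<Sum>i\<in>S. b i)" using insert by (intro sum_nonneg) auto
  have "inf v (b i + (\<Sum>i\<in>S. b i)) \<le> inf v (b i) + inf v (\<Sum>i\<in>S. b i)"
    using insert s by (intro inf_add_le) auto
  also have "\<dots> = 0" using insert by auto
  finally show ?case using insert s by (simp add: antisym)
qed

text \<open>For disjoint summands the sum is the supremum, since \<open>a + b = sup a b + inf a b\<close>.\<close>

lemma sum_disjoint_le:
  fixes v :: "'a::banach_lattice"
  assumes "finite S" "0 \<le> v" "\<And>i. i \<in> S \<Longrightarrow> 0 \<le> b i" "\<And>i. i \<in> S \<Longrightarrow> b i \<le> v"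
    and "\<And>i j. i \<in> S \<Longrightarrow> j \<in> S \<Longrightarrow> i \<noteq> j \<Longrightarrow> inf (b i) (b j) = 0"
  shows "(\<Sum>i\<in>S. b i) \<le> v"
  using assms
proof (induction S rule: finite_induct)
  case (insert i S)
  have "inf (b i) (\<Sum>i\<in>S. b i) = 0"
  proof (rule disjoint_sum)
    fix j assume "j \<in> S"
    then show "inf (b i) (b j) = 0" using insert.hyps insert.prems(4)[of i j] by auto
  qed (use insert.hyps insert.prems(2) in auto)
  then have "b i + (\<Sum>i\<in>S. b i) = sup (b i) (\<Sum>i\<in>S. b i)"
    using add_eq_inf_sup[of "b i" "\<Sum>i\<in>S. b i"] by simp
  moreover have "(\<Sum>i\<in>S. b i) \<le> v"
    by (rule insert.IH) (simp_all add: insert.prems)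
  ultimately show ?case using insert.hyps insert.prems(3) by simp
qed simp

lemma disjoint_pprt: "inf (pprt x) (pprt (- x)) = (0 :: 'a::banach_lattice)"
proof -
  define q where "q = pprt (- x)"
  have "pprt x + nprt x = x" by (rule prts[symmetric])
  moreover have "nprt x = - q" by (simp add: q_def pprt_neg)
  ultimately have "pprt x = x + q" by (simp add: algebra_simps)
  then have "inf (pprt x) q = inf x 0 + q"
    by (simp add: add_inf_distrib_right)
  also have "inf x 0 = nprt x" by (simp add: nprt_def)
  finally show ?thesis using \<open>nprt x = - q\<close> by (simp add: q_def)
qed

text \<open>The positive cone is closed because \<open>(- l)\<^sup>+ \<le> \<bar>x\<^sub>n - l\<bar>\<close> whenever \<open>x\<^sub>n \<ge> 0\<close>.\<close>

lemma nonneg_LIMSEQ: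
  fixes x :: "nat \<Rightarrow> 'a::banach_lattice"
  assumes "x \<longlonglongrightarrow> l" "\<And>n. n \<ge> N \<Longrightarrow> 0 \<le> x n"
  shows "0 \<le> l"
proof -
  have "norm (pprt (- l)) \<le> norm (x n - l)" if "n \<ge> N" for n
  proof -
    have "pprt (- l) \<le> pprt (x n - l)"
      using assms(2)[OF that] by (intro pprt_mono) simp
    then show ?thesis
      using norm_mono_nonneg[OF zero_le_pprt] norm_pprt_le[of "x n - l"] by fastforce
  qed
  moreover have "(\<lambda>n. norm (x n - l)) \<longlonglongrightarrow> 0"
    using assms(1) by (simp add: LIM_zero tendsto_norm_zero)
  ultimately have "norm (pprt (- l)) \<le> 0"
    by (intro LIMSEQ_le_const) auto
  then have "- l \<le> 0" using le_pprt[of "- l"] by simp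
  then show ?thesis by simp
qed


section \<open>The Hahn-Banach theorem\<close>

definition sublinear :: "('a::real_vector \<Rightarrow> real) \<Rightarrow> bool" where
  "sublinear p \<longleftrightarrow> (\<forall>x y. p (x + y) \<le> p x + p y) \<and> (\<forall>c x. 0 \<le> c \<longrightarrow> p (c *\<^sub>R x) = c * p x)"

lemma sublinear_add: "sublinear p \<Longrightarrow> p (x + y) \<le> p x + p y"
  and sublinear_scaleR: "sublinear p \<Longrightarrow> 0 \<le> c \<Longrightarrow> p (c *\<^sub>R x) = c * p x"
  by (auto simp: sublinear_def)

lemma sublinear_0: "sublinear p \<Longrightarrow> p 0 = 0"
  using sublinear_scaleR[of p 0 0] by simp

lemma sublinear_neg_le: "sublinear p \<Longrightarrow> - p (- x) \<le> p x"
  using sublinear_add[of p x "- x"] sublinear_0[of p] by simp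

lemma sublinearI:
  assumes "\<And>x y. p (x + y) \<le> p x + p y" "p 0 = 0"
    and le: "\<And>c x. 0 < c \<Longrightarrow> p (c *\<^sub>R x) \<le> c * p x"
  shows "sublinear p"
  unfolding sublinear_def
proof (intro conjI allI impI)
  fix c :: real and x
  assume "0 \<le> c"
  show "p (c *\<^sub>R x) = c * p x"
  proof (cases "c = 0")
    case False
    with \<open>0 \<le> c\<close> have c: "0 < c" by simp
    have "p x = p (inverse c *\<^sub>R (c *\<^sub>R x))" using c by simp
    also have "\<dots> \<le> inverse c * p (c *\<^sub>R x)" using c by (intro le) simp
    finally have "c * p x \<le> p (c *\<^sub>R x)" using c by (simp add: field_simps)
    with le[OF c] show ?thesis by (simp add: antisym)
  qed (use assms in simp)
qed (use assms in auto)

text \<open>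
  The one construction behind the Hahn-Banach theorem: passing from \<open>q\<close> to
  \<open>inf\<^sub>t (q(x + t x0) - t q(x0))\<close> makes the functional odd at \<open>x0\<close>. It serves twice below, to force
  the value at a prescribed vector and to show that minimal sublinear functionals are linear.
\<close>

lemma sublinear_slide:
  fixes q :: "'a::real_vector \<Rightarrow> real"
  assumes q: "sublinear q"
  obtains r where "sublinear r" "\<And>x. r x \<le> q x" "r (- x0) \<le> - q x0"
proof -
  define r where "r x = (INF t\<in>{0..}. q (x + t *\<^sub>R x0) - t * q x0)" for x
  have bdd: "bdd_below ((\<lambda>t. q (x + t *\<^sub>R x0) - t * q x0) ` {0..})" for x
  proof (rule bdd_belowI2)
    fix t :: real assume "t \<in> {0..}"
    then have "t * q x0 = q ((x + t *\<^sub>R x0) + (- x))"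
      by (simp add: sublinear_scaleR[OF q])
    also have "\<dots> \<le> q (x + t *\<^sub>R x0) + q (- x)" by (rule sublinear_add[OF q])
    finally show "- q (- x) \<le> q (x + t *\<^sub>R x0) - t * q x0" by simp
  qed
  have le: "r x \<le> q (x + t *\<^sub>R x0) - t * q x0" if "0 \<le> t" for x t
    unfolding r_def using that by (intro cINF_lower bdd) simp
  have ge: "a \<le> r x" if "\<And>t. 0 \<le> t \<Longrightarrow> a \<le> q (x + t *\<^sub>R x0) - t * q x0" for a x
    unfolding r_def using that by (intro cINF_greatest) auto
  show ?thesis
  proof (rule that)
    show "sublinear r"
    proof (rule sublinearI)
      fix x y
      have "r (x + y) - r y \<le> r x"
      proof (rule ge)
        fix t :: real assume t: "0 \<le> t"
        have "r (x + y) - (q (x + t *\<^sub>R x0) - t * q x0) \<le> r y"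
        proof (rule ge)
          fix s :: real assume s: "0 \<le> s"
          have "r (x + y) \<le> q ((x + y) + (t + s) *\<^sub>R x0) - (t + s) * q x0"
            using s t by (intro le) simp
          also have "(x + y) + (t + s) *\<^sub>R x0 = (x + t *\<^sub>R x0) + (y + s *\<^sub>R x0)"
            by (simp add: scaleR_add_left)
          also have "q \<dots> \<le> q (x + t *\<^sub>R x0) + q (y + s *\<^sub>R x0)"
            by (rule sublinear_add[OF q])
          finally show "r (x + y) - (q (x + t *\<^sub>R x0) - t * q x0) \<le> q (y + s *\<^sub>R x0) - s * q x0"
            by (simp add: algebra_simps)
        qed
        then show "r (x + y) - r y \<le> q (x + t *\<^sub>R x0) - t * q x0" by simp
      qed
      then show "r (x + y) \<le> r x + r y" by simp
    next
      show "r 0 = 0"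
        using le[of 0 0] ge[of 0 0] by (simp add: sublinear_scaleR[OF q] sublinear_0[OF q])
    next
      fix c :: real and x assume c: "0 < c"
      have "inverse c * r (c *\<^sub>R x) \<le> r x"
      proof (rule ge)
        fix t :: real assume t: "0 \<le> t"
        have "r (c *\<^sub>R x) \<le> q (c *\<^sub>R x + (c * t) *\<^sub>R x0) - (c * t) * q x0"
          using c t by (intro le) simp
        also have "c *\<^sub>R x + (c * t) *\<^sub>R x0 = c *\<^sub>R (x + t *\<^sub>R x0)"
          by (simp add: scaleR_add_right)
        also have "q \<dots> = c * q (x + t *\<^sub>R x0)" using c by (simp add: sublinear_scaleR[OF q])
        finally show "inverse c * r (c *\<^sub>R x) \<le> q (x + t *\<^sub>R x0) - t * q x0"
          using c by (simp add: field_simps)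
      qed
      then show "r (c *\<^sub>R x) \<le> c * r x" using c by (simp add: field_simps)
    qed
    show "r x \<le> q x" for x using le[of 0 x] by simp
    show "r (- x0) \<le> - q x0" using le[of 1 "- x0"] by (simp add: sublinear_0[OF q])
  qed
qed

text \<open>
  The domination by \<open>p\<close> keeps the pointwise infimum finite: a sublinear \<open>q \<le> p\<close> satisfies
  \<open>- p(- x) \<le> q(x)\<close>. Subadditivity survives because any two members of a chain are comparable.
\<close>

lemma sublinear_chain_INF:
  assumes p: "sublinear p" and "C \<noteq> {}"
    and C: "\<And>q. q \<in> C \<Longrightarrow> sublinear q" "\<And>q x. q \<in> C \<Longrightarrow> q x \<le> p x"
    and chain: "\<And>q q'. q \<in> C \<Longrightarrow> q' \<in> C \<Longrightarrow> q \<le> q' \<or> q' \<le> q"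
  obtains m where "sublinear m" "\<And>q x. q \<in> C \<Longrightarrow> m x \<le> q x"
proof -
  define m where "m x = (INF q\<in>C. q x)" for x
  have bdd: "bdd_below ((\<lambda>q. q x) ` C)" for x
  proof (rule bdd_belowI2)
    fix q assume q: "q \<in> C"
    show "- p (- x) \<le> q x"
      using sublinear_neg_le[OF C(1)[OF q], of x] C(2)[OF q, of "- x"] by simp
  qed
  have le: "m x \<le> q x" if "q \<in> C" for q x
    unfolding m_def using that by (intro cINF_lower bdd)
  have ge: "a \<le> m x" if "\<And>q. q \<in> C \<Longrightarrow> a \<le> q x" for a x
    unfolding m_def using that \<open>C \<noteq> {}\<close> by (intro cINF_greatest)
  have "sublinear m"
  proof (rule sublinearI)
    fix x y
    have "m (x + y) - m y \<le> m x"
    proof (rule ge)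
      fix q assume q: "q \<in> C"
      have "m (x + y) - q x \<le> m y"
      proof (rule ge)
        fix q' assume q': "q' \<in> C"
        have *: "m (x + y) \<le> q'' x + q'' y" if "q'' \<in> C" for q''
          using le[OF that, of "x + y"] sublinear_add[OF C(1)[OF that], of x y] by simp
        from chain[OF q q'] show "m (x + y) - q x \<le> q' y"
        proof
          assume "q \<le> q'"
          then show ?thesis using *[OF q] le_funD[of q q' y] by linarith
        next
          assume "q' \<le> q"
          then show ?thesis using *[OF q'] le_funD[of q' q x] by linarith
        qed
      qed
      then show "m (x + y) - m y \<le> q x" by simp
    qed
    then show "m (x + y) \<le> m x + m y" by simp
  next
    obtain q where "q \<in> C" using \<open>C \<noteq> {}\<close> by blast
    then show "m 0 = 0"
      using le[of q 0] ge[of 0 0] sublinear_0[OF C(1)] by (metis order.antisym order.refl)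
  next
    fix c :: real and x assume c: "0 < c"
    have "inverse c * m (c *\<^sub>R x) \<le> m x"
    proof (rule ge)
      fix q assume q: "q \<in> C"
      show "inverse c * m (c *\<^sub>R x) \<le> q x"
        using le[OF q, of "c *\<^sub>R x"] sublinear_scaleR[OF C(1)[OF q], of c x] c
        by (simp add: field_simps)
    qed
    then show "m (c *\<^sub>R x) \<le> c * m x" using c by (simp add: field_simps)
  qed
  with le show ?thesis using that by blast
qed

text \<open>
  A minimal sublinear functional is odd, for otherwise sliding it along some vector would give a
  smaller one; an odd sublinear functional is linear. Sliding \<open>p\<close> along \<open>x0\<close> before applying Zorn's
  lemma fixes the value at \<open>x0\<close>.
\<close>

theorem hahn_banach_sublinear:
  fixes p :: "'a::real_vector \<Rightarrow> real"
  assumes p: "sublinear p"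
  obtains f where "linear f" "\<And>x. f x \<le> p x" "f x0 = p x0"
proof -
  obtain r where r: "sublinear r" "\<And>x. r x \<le> p x" "r (- x0) \<le> - p x0"
    using sublinear_slide[OF p] by blast
  define A where "A = {q. sublinear q \<and> q \<le> r}"
  have "\<exists>m\<in>A. \<forall>q\<in>A. q \<le> m \<longrightarrow> q = m"
  proof (rule predicate_Zorn)
    show "partial_order_on A (relation_of (\<lambda>f g. g \<le> f) A)"
      by (rule partial_order_on_relation_ofI) auto
  next
    fix C assume C: "C \<in> Chains (relation_of (\<lambda>f g. g \<le> f) A)"
    show "\<exists>u\<in>A. \<forall>q\<in>C. u \<le> q"
    proof (cases "C = {}")
      case True
      then show ?thesis using r(1) by (auto simp: A_def)
    next
      case False
      have CA: "C \<subseteq> A" using C by (auto simp: Chains_def relation_of_def)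
      have chain: "q \<le> q' \<or> q' \<le> q" if "q \<in> C" "q' \<in> C" for q q'
        using C that by (auto simp: Chains_def relation_of_def)
      obtain m where m: "sublinear m" "\<And>q x. q \<in> C \<Longrightarrow> m x \<le> q x"
        using sublinear_chain_INF[OF r(1) False _ _ chain] CA
        by (auto simp: A_def subset_eq le_fun_def)
      obtain q where "q \<in> C" using False by blast
      then have "m x \<le> r x" for x
        using m(2)[of q x] CA le_funD[of q r x] by (force simp: A_def)
      then have "m \<in> A" using m(1) by (simp add: A_def le_fun_def)
      with m show ?thesis by (auto simp: le_fun_def)
    qed
  qed
  then obtain m where "m \<in> A" and min_A: "\<And>q. q \<in> A \<Longrightarrow> q \<le> m \<Longrightarrow> q = m" by blast
  then have m: "sublinear m" "m \<le> r" by (simp_all add: A_def)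
  have min: "q = m" if "sublinear q" "q \<le> m" for q
    using that order_trans[OF that(2) m(2)] by (intro min_A) (simp_all add: A_def)
  have odd: "m (- y) = - m y" for y
  proof -
    obtain q where q: "sublinear q" "\<And>x. q x \<le> m x" "q (- y) \<le> - m y"
      using sublinear_slide[OF m(1)] by blast
    then have "q = m" by (intro min) (auto simp: le_fun_def)
    with q sublinear_neg_le[OF m(1), of y] show ?thesis by simp
  qed
  have "linear m"
  proof (rule linearI)
    fix x y
    have "m (- x + - y) \<le> m (- x) + m (- y)" by (rule sublinear_add[OF m(1)])
    then have "m x + m y \<le> m (x + y)"
      using odd[of "x + y"] by (simp add: odd)
    then show "m (x + y) = m x + m y"
      using sublinear_add[OF m(1), of x y] by simp
  next
    fix c :: real and x
    show "m (c *\<^sub>R x) = c *\<^sub>R m x"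
    proof (cases "0 \<le> c")
      case False
      then show ?thesis
        using sublinear_scaleR[OF m(1), of "- c" x] odd[of "c *\<^sub>R x"] by simp
    qed (simp add: sublinear_scaleR[OF m(1)])
  qed
  moreover have "m x \<le> p x" for x
    using m(2) r(2) by (metis le_funD order_trans)
  moreover have "m x0 = p x0"
    using m(2) r(3) odd[of x0] calculation(2)[of x0] le_funD[OF m(2), of "- x0"] by simp
  ultimately show ?thesis using that by blast
qed

lemma bounded_linear_if_le_norm:
  fixes f :: "'a::real_normed_vector \<Rightarrow> real"
  assumes "linear f" "\<And>x. f x \<le> C * norm x"
  shows "bounded_linear f"
proof -
  have "norm (f x) \<le> norm x * C" for x
    using assms(2)[of x] assms(2)[of "- x"] linear_neg[OF assms(1), of x]
    by (simp add: mult.commute)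
  then show ?thesis
    using assms(1) by (intro bounded_linear_intro[of f C]) (auto simp: linear_add linear_scale)
qed

lemma norming_functional:
  fixes x0 :: "'a::real_normed_vector"
  obtains f :: "'a \<Rightarrow> real" where "bounded_linear f" "\<And>x. \<bar>f x\<bar> \<le> norm x" "f x0 = norm x0"
proof -
  have "sublinear (norm :: 'a \<Rightarrow> real)"
    by (auto simp: sublinear_def norm_triangle_ineq)
  then obtain f :: "'a \<Rightarrow> real" where f: "linear f" "\<And>x. f x \<le> norm x" "f x0 = norm x0"
    using hahn_banach_sublinear by blast
  then have "bounded_linear f" by (intro bounded_linear_if_le_norm[of f 1]) auto
  moreover have "\<bar>f x\<bar> \<le> norm x" for x
    using f(2)[of x] f(2)[of "- x"] linear_neg[OF f(1), of x] by simp
  ultimately show ?thesis using f that by blast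
qed

text \<open>
  A functional dominated by the norm of the positive part is automatically positive, because that
  seminorm vanishes at \<open>- x\<close> for \<open>x \<ge> 0\<close>.
\<close>

lemma positive_functional:
  fixes x0 :: "'a::banach_lattice"
  assumes "0 \<le> x0"
  obtains f :: "'a \<Rightarrow> real" where "bounded_linear f" "\<And>x. 0 \<le> x \<Longrightarrow> 0 \<le> f x" "f x0 = norm x0"
proof -
  have "norm (pprt (x + y)) \<le> norm (pprt x) + norm (pprt y)" for x y :: 'a
    using norm_mono_nonneg[OF zero_le_pprt pprt_add_le, of x y]
      norm_triangle_ineq[of "pprt x" "pprt y"] by linarith
  then have "sublinear (\<lambda>x :: 'a. norm (pprt x))"
    by (simp add: sublinear_def pprt_scaleR)
  then obtain f :: "'a \<Rightarrow> real"
    where f: "linear f" "\<And>x. f x \<le> norm (pprt x)" "f x0 = norm (pprt x0)"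
    using hahn_banach_sublinear by blast
  have "bounded_linear f"
    using f order_trans[OF f(2) norm_pprt_le] by (intro bounded_linear_if_le_norm[of f 1]) auto
  moreover have "0 \<le> f x" if "0 \<le> x" for x
    using f(2)[of "- x"] that linear_neg[OF f(1), of x] by simp
  ultimately show ?thesis using f that assms by simp
qed


section \<open>Relatively weakly compact sets\<close>

lemma openin_weak_topology:
  fixes f :: "'a::real_normed_vector \<Rightarrow> real"
  assumes "bounded_linear f" "open U"
  shows "openin weak_topology (f -` U)"
  unfolding weak_topology_def using assms by (intro topology_generated_by_Basis) blast

lemma topspace_weak_topology: "topspace weak_topology = (UNIV :: 'a::real_normed_vector set)"
proof -
  have "openin weak_topology ((\<lambda>_ :: 'a. 0 :: real) -` UNIV)"
    by (intro openin_weak_topology) auto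
  then show ?thesis using openin_subset by fastforce
qed

lemma relatively_weakly_compact_singleton:
  "relatively_weakly_compact {x0 :: 'a::real_normed_vector}"
proof -
  have "weak_topology closure_of {x0} \<subseteq> {x0}"
  proof
    fix x assume x: "x \<in> weak_topology closure_of {x0}"
    have nhd: "x0 \<in> T" if "x \<in> T" "openin weak_topology T" for T
      using x that by (simp add: in_closure_of)
    obtain f :: "'a \<Rightarrow> real" where f: "bounded_linear f" "f (x - x0) = norm (x - x0)"
      using norming_functional by blast
    show "x \<in> {x0}"
    proof (rule ccontr)
      assume "x \<notin> {x0}"
      then have "f x \<noteq> f x0"
        using f by (auto simp: linear_diff[OF bounded_linear.linear])
      moreover have "openin weak_topology (f -` (- {f x0}))"
        using f(1) by (intro openin_weak_topology) auto
      ultimately have "x \<in> f -` (- {f x0})" "openin weak_topology (f -` (- {f x0}))" by simp_all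
      then have "x0 \<in> f -` (- {f x0})" by (rule nhd)
      then show False by simp
    qed
  qed
  then have "finite (weak_topology closure_of {x0})" by (rule finite_subset) simp
  then show ?thesis
    unfolding relatively_weakly_compact_def
    by (intro finite_imp_compactin closure_of_subset_topspace)
qed

text \<open>
  \<open>w\<close> is a cluster point of the sequence in the weak topology, written with basic neighbourhoods. A
  cluster point of a sequence is all that the arguments below use, so that no weakly convergent
  subsequence has to be extracted.
\<close>

definition weakly_clusters :: "(nat \<Rightarrow> 'a::real_normed_vector) \<Rightarrow> 'a \<Rightarrow> bool" where
  "weakly_clusters y w \<longleftrightarrow> (\<forall>(F :: ('a \<Rightarrow> real) set) \<delta> N.
     finite F \<longrightarrow> (\<forall>f\<in>F. bounded_linear f) \<longrightarrow> 0 < \<delta> \<longrightarrow> (\<exists>n\<ge>N. \<forall>f\<in>F. \<bar>f (y n - w)\<bar> < \<delta>))"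

lemma weakly_clustersD:
  fixes F :: "('a::real_normed_vector \<Rightarrow> real) set"
  assumes "weakly_clusters y w" "finite F" "\<And>f. f \<in> F \<Longrightarrow> bounded_linear f" "0 < \<delta>"
  shows "\<exists>n\<ge>N. \<forall>f\<in>F. \<bar>f (y n - w)\<bar> < \<delta>"
  using assms unfolding weakly_clusters_def by blast

text \<open>
  If no point were a cluster point, the closure would be covered by open sets each of which the
  sequence eventually leaves; a finite subcover leaves no room for late terms.
\<close>

lemma weak_cluster_point:
  fixes y :: "nat \<Rightarrow> 'a::real_normed_vector"
  assumes A: "relatively_weakly_compact A" and y: "\<And>n. y n \<in> A"
  obtains w where "weakly_clusters y w"
proof -
  have "\<exists>w. weakly_clusters y w"
  proof (rule ccontr)
    assume "\<not> ?thesis"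
    then have "\<forall>w. \<exists>(F :: ('a \<Rightarrow> real) set) \<delta> N. finite F \<and> (\<forall>f\<in>F. bounded_linear f) \<and> 0 < \<delta> \<and>
      (\<forall>n\<ge>N. \<exists>f\<in>F. \<delta> \<le> \<bar>f (y n - w)\<bar>)"
      by (simp add: not_less weakly_clusters_def)
    then obtain F :: "'a \<Rightarrow> ('a \<Rightarrow> real) set" and \<delta> N
      where F: "\<And>w. finite (F w)" "\<And>w f. f \<in> F w \<Longrightarrow> bounded_linear f" "\<And>w. 0 < \<delta> w"
        and N: "\<And>w n. n \<ge> N w \<Longrightarrow> \<exists>f\<in>F w. \<delta> w \<le> \<bar>f (y n - w)\<bar>"
      by metis
    define U where "U w = (\<Inter>f\<in>F w. f -` ball (f w) (\<delta> w))" for w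
    have F_ne: "F w \<noteq> {}" for w using N[of w "N w"] by auto
    have "openin weak_topology (U w)" for w
      unfolding U_def using F F_ne by (intro openin_INT2 openin_weak_topology) auto
    moreover have "w \<in> U w" for w using F by (simp add: U_def)
    then have "weak_topology closure_of A \<subseteq> (\<Union>w\<in>UNIV. U w)" by blast
    ultimately obtain \<F> where \<F>: "finite \<F>" "\<F> \<subseteq> range U" "weak_topology closure_of A \<subseteq> \<Union>\<F>"
      using A unfolding relatively_weakly_compact_def compactin_def by (metis (no_types, lifting) rangeE)
    then obtain W where W: "finite W" "\<F> = U ` W" by (meson finite_subset_image)
    define n where "n = Max (insert 0 (N ` W))"
    have "y n \<in> weak_topology closure_of A"
      using y[of n] closure_of_subset[of A weak_topology] by (auto simp: topspace_weak_topology)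
    then obtain w where w: "w \<in> W" "y n \<in> U w" using \<F> W by blast
    have "N w \<le> n" unfolding n_def using W w by (intro Max_ge) auto
    then obtain f where f: "f \<in> F w" "\<delta> w \<le> \<bar>f (y n - w)\<bar>" using N by blast
    have "f (y n - w) = f (y n) - f w"
      using F(2)[OF f(1)] by (simp add: linear_diff[OF bounded_linear.linear])
    with w(2) f show False by (auto simp: U_def dist_real_def)
  qed
  then show ?thesis using that by blast
qed

text \<open>
  The Baire category theorem in the dual space: the closed sets \<open>G n\<close> of functionals that are bounded
  by \<open>n\<close> on \<open>A\<close> cover the dual, so one of them contains a ball, and norming functionals turn the bound
  on that ball into a bound on the norms of the elements of \<open>A\<close>.
\<close>

lemma uniform_boundedness:
  fixes A :: "'a::banach set"
  assumes bdd: "\<And>f :: 'a \<Rightarrow> real. bounded_linear f \<Longrightarrow> \<exists>C. \<forall>a\<in>A. \<bar>f a\<bar> \<le> C"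
  shows "bounded A"
proof -
  define G where "G n = {f :: 'a \<Rightarrow>\<^sub>L real. \<forall>a\<in>A. \<bar>f a\<bar> \<le> real n}" for n
  have closed: "closed (G n)" for n
  proof -
    have "G n = (\<Inter>a\<in>A. {f. \<bar>blinfun_apply f a\<bar> \<le> real n})" by (auto simp: G_def)
    moreover have "closed {f :: 'a \<Rightarrow>\<^sub>L real. \<bar>blinfun_apply f a\<bar> \<le> real n}" for a
      by (intro closed_Collect_le continuous_intros)
    ultimately show ?thesis by auto
  qed
  have UN: "(\<Union>n. G n) = UNIV"
  proof -
    have "\<exists>n. f \<in> G n" for f
    proof -
      obtain C where "\<forall>a\<in>A. \<bar>blinfun_apply f a\<bar> \<le> C"
        using bdd[of "blinfun_apply f"] blinfun.bounded_linear_right by blast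
      moreover obtain n where "C \<le> real n" using real_arch_simple by blast
      ultimately have "f \<in> G n" by (auto simp: G_def intro: order_trans)
      then show ?thesis ..
    qed
    then show ?thesis by blast
  qed
  have "\<exists>n. interior (G n) \<noteq> {}"
  proof (rule ccontr)
    assume "\<not> ?thesis"
    then have "(euclidean :: ('a \<Rightarrow>\<^sub>L real) topology) interior_of \<Union>(range G) = {}"
      using closed by (intro Baire_category_alt) (auto simp: completely_metrizable_space_euclidean simp flip: closed_closedin)
    then show False using UN by simp
  qed
  then obtain n f0 where "f0 \<in> interior (G n)" by blast
  then obtain r where r: "0 < r" "cball f0 r \<subseteq> G n"
    by (meson mem_interior_cball)
  show ?thesis
    unfolding bounded_iff
  proof (intro exI ballI)
    fix a assume a: "a \<in> A"
    obtain g :: "'a \<Rightarrow> real" where g: "bounded_linear g" "\<And>x. \<bar>g x\<bar> \<le> norm x" "g a = norm a"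
      using norming_functional by blast
    have app: "blinfun_apply (Blinfun g) = g" using g(1) by (rule bounded_linear_Blinfun_apply)
    have "norm (Blinfun g) \<le> 1" using g(2) by (intro norm_blinfun_bound) (auto simp: app)
    then have "f0 + r *\<^sub>R Blinfun g \<in> cball f0 r" "f0 \<in> cball f0 r"
      using r(1) by (simp_all add: dist_norm mult_left_le)
    then have "f0 + r *\<^sub>R Blinfun g \<in> G n" "f0 \<in> G n" using r(2) by blast+
    then have "\<bar>f0 a + r * norm a\<bar> \<le> n" "\<bar>f0 a\<bar> \<le> n"
      using a g(3) by (auto simp: G_def blinfun.add_left blinfun.scaleR_left app)
    then have "r * norm a \<le> 2 * n" by linarith
    then show "norm a \<le> 2 * n / r" using r(1) by (simp add: field_simps)
  qed
qed

lemma relatively_weakly_compact_imp_bounded: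
  fixes A :: "'a::banach set"
  assumes A: "relatively_weakly_compact A"
  shows "bounded A"
proof (rule uniform_boundedness, rule ccontr)
  fix f :: "'a \<Rightarrow> real"
  assume f: "bounded_linear f" and "\<nexists>C. \<forall>a\<in>A. \<bar>f a\<bar> \<le> C"
  then have "\<forall>n::nat. \<exists>a\<in>A. real n < \<bar>f a\<bar>" by (simp add: not_le)
  then obtain y where y: "\<And>n. y n \<in> A" "\<And>n. real n < \<bar>f (y n)\<bar>" by metis
  obtain w where w: "weakly_clusters y w"
    using weak_cluster_point[of A y] A y(1) by blast
  obtain N where N: "\<bar>f w\<bar> + 1 \<le> real N" using real_arch_simple by blast
  obtain n where n: "n \<ge> N" "\<bar>f (y n - w)\<bar> < 1"
    using weakly_clustersD[OF w, of "{f}" 1 N] f by auto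
  have "f (y n - w) = f (y n) - f w" using f by (simp add: linear_diff[OF bounded_linear.linear])
  with n N y(2)[of n] show False by linarith
qed

text \<open>
  The sequence \<open>g\<close> is an operator into \<open>\<ell>\<^sub>1\<close>, and the lemma expresses the Schur property: the image of
  \<open>A\<close> has uniformly small coordinates far out. Let \<open>w\<close> be a weak cluster point of \<open>y\<close> and consider
  the matrix \<open>b k j = g j (y k - w)\<close>, whose rows are summable and whose diagonal entries are eventually
  at least \<open>\<epsilon>/2\<close> in absolute value. Indices \<open>k 0 < k 1 < \<dots>\<close> are chosen so that in row
  \<open>k (n + 1)\<close> the entries up to column \<open>k n\<close> and those from column \<open>k (n + 2)\<close> on have small sum.
  The sum \<open>G\<close> of the functionals \<open>g (k n)\<close> then sees in row \<open>k n\<close> essentially the diagonal entry. But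
  along the chosen rows every column tends to \<open>0\<close>, so no \<open>g j\<close>, and hence not \<open>G\<close> either,
  distinguishes \<open>w\<close> from a weak cluster point \<open>w'\<close> of the subsequence, so \<open>G\<close> has to be small on some of
  these rows.
\<close>

lemma gliding_hump:
  fixes g :: "nat \<Rightarrow> 'a::banach \<Rightarrow> real"
  assumes A: "relatively_weakly_compact A" and y: "\<And>n. y n \<in> A"
    and g: "\<And>n. bounded_linear (g n)"
    and sum_g: "\<And>N z. (\<Sum>n<N. \<bar>g n z\<bar>) \<le> C * norm z"
    and \<epsilon>: "0 < \<epsilon>" "\<And>n. \<epsilon> \<le> \<bar>g n (y n)\<bar>"
  shows False
proof -
  have sm: "summable (\<lambda>n. \<bar>g n z\<bar>)" for z
    by (rule summableI_nonneg_bounded[OF _ sum_g]) simp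
  have diff: "g n (a - b) = g n a - g n b" for n a b
    by (simp add: linear_diff[OF bounded_linear.linear[OF g]])
  obtain w where w: "weakly_clusters y w"
    using weak_cluster_point[of A y] A y by blast
  define b where "b k j = g j (y k - w)" for k j
  have "(\<lambda>n. \<bar>g n w\<bar>) \<longlonglongrightarrow> 0" by (rule summable_LIMSEQ_zero[OF sm])
  then have "\<forall>\<^sub>F n in sequentially. \<bar>g n w\<bar> < \<epsilon> / 2"
    using \<epsilon>(1) by (intro order_tendstoD(2)) auto
  then obtain K0 where K0: "\<And>n. n \<ge> K0 \<Longrightarrow> \<bar>g n w\<bar> < \<epsilon> / 2"
    by (auto simp: eventually_sequentially)
  have diag: "\<epsilon> / 2 \<le> \<bar>b k k\<bar>" if "k \<ge> K0" for k
    using K0[OF that] \<epsilon>(2)[of k] unfolding b_def diff by linarith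
  have "\<exists>k. \<forall>n. K0 \<le> k n \<and> (k n < k (Suc n) \<and>
      (\<Sum>j\<le>k n. \<bar>b (k (Suc n)) j\<bar>) < \<epsilon> / 8 / real (Suc n) \<and>
      (\<Sum>j. \<bar>b (k n) (j + k (Suc n))\<bar>) < \<epsilon> / 8)"
  proof (rule dependent_nat_choice)
    show "\<exists>k. K0 \<le> k" by blast
  next
    fix k n assume k: "K0 \<le> k"
    obtain M where M: "\<And>m. m \<ge> M \<Longrightarrow> norm (\<Sum>j. \<bar>b k (j + m)\<bar>) < \<epsilon> / 8"
      using suminf_exist_split[of "\<epsilon> / 8" "\<lambda>j. \<bar>b k j\<bar>"] \<epsilon>(1) sm[of "y k - w"]
      by (auto simp: b_def)
    define \<delta> where "\<delta> = \<epsilon> / 8 / real (Suc n)"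
    have "0 < \<delta>" using \<epsilon>(1) by (simp add: \<delta>_def)
    then obtain k' where k': "k' \<ge> max M (Suc k)" "\<And>j. j \<le> k \<Longrightarrow> \<bar>b k' j\<bar> < \<delta> / real (Suc k)"
      using weakly_clustersD[OF w, of "g ` {..k}" "\<delta> / real (Suc k)" "max M (Suc k)"] g by (auto simp: b_def)
    have "(\<Sum>j\<le>k. \<bar>b k' j\<bar>) < (\<Sum>j\<le>k. \<delta> / real (Suc k))"
      using k'(2) by (intro sum_strict_mono) auto
    also have "\<dots> = \<delta>" by simp
    finally show "\<exists>k'. K0 \<le> k' \<and> k < k' \<and> (\<Sum>j\<le>k. \<bar>b k' j\<bar>) < \<epsilon> / 8 / real (Suc n) \<and>
        (\<Sum>j. \<bar>b k (j + k')\<bar>) < \<epsilon> / 8"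
      using k k'(1) M[of k'] unfolding \<delta>_def by (intro exI[of _ k']) auto
  qed
  then obtain k where k: "\<And>n. K0 \<le> k n" "\<And>n. k n < k (Suc n)"
      "\<And>n. (\<Sum>j\<le>k n. \<bar>b (k (Suc n)) j\<bar>) < \<epsilon> / 8 / real (Suc n)"
      "\<And>n. (\<Sum>j. \<bar>b (k n) (j + k (Suc n))\<bar>) < \<epsilon> / 8"
    by blast
  have k_mono: "strict_mono k" using k(2) by (simp add: strict_mono_Suc_iff)
  define \<theta> :: "nat \<Rightarrow> real" where "\<theta> j = (if j \<in> range k then 1 else 0)" for j
  have \<theta>_le: "\<bar>\<theta> j * x\<bar> \<le> \<bar>x\<bar>" for j x by (simp add: \<theta>_def)
  define G where "G z = (\<Sum>j. \<theta> j * g j z)" for z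
  have smG: "summable (\<lambda>j. \<theta> j * g j z)" for z
    by (rule summable_comparison_test'[OF sm[of z], of 0]) (simp add: \<theta>_le)
  have "linear G"
  proof (rule linearI)
    show "G (u + v) = G u + G v" for u v
      unfolding G_def suminf_add[OF smG smG]
      by (simp add: linear_add[OF bounded_linear.linear[OF g]] distrib_left)
    show "G (c *\<^sub>R u) = c *\<^sub>R G u" for c u
      using suminf_mult[OF smG, of c u]
      by (simp add: G_def linear_scale[OF bounded_linear.linear[OF g]] mult.left_commute)
  qed
  moreover have "G z \<le> C * norm z" for z
  proof -
    have "G z \<le> (\<Sum>j. \<bar>g j z\<bar>)"
      unfolding G_def using \<theta>_le by (intro suminf_le smG sm) (meson abs_le_D1)
    also have "\<dots> \<le> C * norm z" by (rule suminf_le_const[OF sm sum_g])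
    finally show ?thesis .
  qed
  ultimately have G: "bounded_linear G" by (rule bounded_linear_if_le_norm)
  have hump: "\<epsilon> / 4 \<le> \<bar>G (y (k (Suc n)) - w)\<bar>" for n
  proof -
    define l m m' where "l = k n" and "m = k (Suc n)" and "m' = k (Suc (Suc n))"
    have lm: "l < m" "m < m'" using k(2) by (simp_all add: l_def m_def m'_def)
    \<comment> \<open>\<open>h\<close> is row \<open>m\<close> restricted to the chosen columns, without its diagonal entry; \<open>c\<close> dominates it
      and does not depend on which columns outside the gap between \<open>l\<close> and \<open>m'\<close> were chosen.\<close>
    define c where "c j = (if j \<le> l \<or> m' \<le> j then \<bar>b m j\<bar> else 0)" for j
    define h where "h j = \<theta> j * b m j - (if j = m then b m m else 0)" for j
    have \<theta>m: "\<theta> m = 1" by (simp add: \<theta>_def m_def)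
    have gap: "\<theta> j = 0" if "l < j" "j < m'" "j \<noteq> m" for j
    proof -
      have "j \<noteq> k i" for i
      proof
        assume "j = k i"
        moreover from this have "i \<noteq> Suc n" using that(3) by (auto simp: m_def)
        ultimately have "n < i" "i < Suc (Suc n)"
          using that by (auto simp: l_def m_def m'_def strict_mono_less[OF k_mono])
        then have "i = Suc n" by simp
        with \<open>i \<noteq> Suc n\<close> show False ..
      qed
      then show ?thesis by (auto simp: \<theta>_def)
    qed
    have hc: "\<bar>h j\<bar> \<le> c j" for j
    proof (cases "j = m")
      case True
      then show ?thesis by (simp add: h_def c_def \<theta>m)
    next
      case False
      then show ?thesis using gap[of j] \<theta>_le[of j "b m j"] by (auto simp: h_def c_def)
    qed
    have smc: "summable c"
      by (rule summable_comparison_test'[OF sm[of "y m - w"], of 0]) (simp add: c_def b_def)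
    have smh: "summable h"
      by (rule summable_comparison_test'[OF smc, of 0]) (simp add: hc)
    have "\<bar>suminf h\<bar> \<le> suminf c"
      using norm_suminf_le[of h c] hc smc by simp
    also have "suminf c = (\<Sum>j. c (j + m')) + (\<Sum>j<m'. c j)"
      by (rule suminf_split_initial_segment[OF smc])
    also have "(\<Sum>j<m'. c j) = (\<Sum>j\<le>l. \<bar>b m j\<bar>)"
      using lm by (intro sum.mono_neutral_cong_right) (auto simp: c_def)
    also have "\<dots> < \<epsilon> / 8 / real (Suc n)" using k(3)[of n] by (simp add: l_def m_def)
    also have "\<dots> \<le> \<epsilon> / 8" using \<epsilon>(1) by (simp add: field_simps)
    also have "(\<Sum>j. c (j + m')) = (\<Sum>j. \<bar>b m (j + m')\<bar>)" by (simp add: c_def)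
    also have "\<dots> < \<epsilon> / 8" using k(4)[of "Suc n"] by (simp add: m_def m'_def)
    finally have "\<bar>suminf h\<bar> < \<epsilon> / 4" by simp
    moreover have "h sums (G (y m - w) - b m m)"
      unfolding h_def
    proof (rule sums_diff)
      show "(\<lambda>j. \<theta> j * b m j) sums G (y m - w)"
        using summable_sums[OF smG[of "y m - w"]] by (simp add: G_def b_def)
      show "(\<lambda>j. if j = m then b m m else 0) sums b m m"
        using sums_single[of m "\<lambda>_. b m m"] by simp
    qed
    then have "suminf h = G (y m - w) - b m m" by (simp add: sums_iff)
    moreover have "\<epsilon> / 2 \<le> \<bar>b m m\<bar>" using diag k(1) by (simp add: m_def)
    ultimately show ?thesis unfolding m_def by linarith
  qed
  obtain w' where w': "weakly_clusters (\<lambda>n. y (k n)) w'"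
    using weak_cluster_point[OF A, of "\<lambda>n. y (k n)"] y by blast
  have g_w': "g j (w' - w) = 0" for j
  proof -
    have "\<bar>g j (w' - w)\<bar> \<le> 0 + \<delta>" if \<delta>: "0 < \<delta>" for \<delta>
    proof -
      obtain N where N: "\<epsilon> / 8 / (\<delta> / 2) < real N" using reals_Archimedean2 by blast
      obtain n where n: "n \<ge> Suc (max N j)" "\<bar>g j (y (k n) - w')\<bar> < \<delta> / 2"
        using weakly_clustersD[OF w', of "{g j}" "\<delta> / 2" "Suc (max N j)"] g \<delta> by auto
      then obtain n' where n': "n = Suc n'" "N \<le> n'" "j \<le> n'" by (cases n) auto
      have "j \<le> k n'" using n'(3) seq_suble[OF k_mono, of n'] by simp
      then have "\<bar>b (k n) j\<bar> \<le> (\<Sum>j\<le>k n'. \<bar>b (k n) j\<bar>)"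
        by (intro member_le_sum) auto
      also have "\<dots> < \<epsilon> / 8 / real (Suc n')" using k(3)[of n'] n'(1) by simp
      also have "\<dots> \<le> \<delta> / 2"
      proof -
        have "\<epsilon> / 8 < real N * (\<delta> / 2)" using N \<delta> by (simp add: field_simps)
        also have "\<dots> \<le> real (Suc n') * (\<delta> / 2)" using n'(2) \<delta> by (intro mult_right_mono) auto
        finally show ?thesis by (simp add: field_simps)
      qed
      finally show ?thesis using n(2) unfolding b_def diff by linarith
    qed
    then show ?thesis using field_le_epsilon[of "\<bar>g j (w' - w)\<bar>" 0] by simp
  qed
  obtain n where n: "n \<ge> 1" "\<bar>G (y (k n) - w')\<bar> < \<epsilon> / 4"
    using weakly_clustersD[OF w', of "{G}" "\<epsilon> / 4" 1] G \<epsilon>(1) by auto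
  have "G (w' - w) = 0" by (simp add: G_def g_w')
  then have "G (y (k n) - w) = G (y (k n) - w')"
    by (simp add: linear_diff[OF bounded_linear.linear[OF G]])
  moreover have "\<epsilon> / 4 \<le> \<bar>G (y (k n) - w)\<bar>" using hump[of "n - 1"] n(1) by simp
  ultimately show False using n(2) by simp
qed

text \<open>The hypotheses of \<open>gliding_hump\<close> pass to subsequences.\<close>

lemma tendsto_on_relatively_weakly_compact:
  fixes g :: "nat \<Rightarrow> 'a::banach \<Rightarrow> real"
  assumes A: "relatively_weakly_compact A" and y: "\<And>n. y n \<in> A"
    and g: "\<And>n. bounded_linear (g n)"
    and sum_g: "\<And>N z. (\<Sum>n<N. \<bar>g n z\<bar>) \<le> C * norm z"
  shows "(\<lambda>n. g n (y n)) \<longlonglongrightarrow> 0"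
proof (rule ccontr)
  assume "\<not> ?thesis"
  then obtain \<epsilon> where \<epsilon>: "0 < \<epsilon>" "\<And>N. \<exists>n\<ge>N. \<epsilon> \<le> \<bar>g n (y n)\<bar>"
    unfolding lim_sequentially by (auto simp: not_less)
  then have "infinite {n. \<epsilon> \<le> \<bar>g n (y n)\<bar>}"
    unfolding infinite_nat_iff_unbounded_le by blast
  then obtain r :: "nat \<Rightarrow> nat" where r: "strict_mono r" "\<And>n. r n \<in> {n. \<epsilon> \<le> \<bar>g n (y n)\<bar>}"
    using infinite_enumerate by blast
  show False
  proof (rule gliding_hump[OF A, of "y \<circ> r" "g \<circ> r" C \<epsilon>])
    fix N z
    have "(\<Sum>n<N. \<bar>(g \<circ> r) n z\<bar>) = (\<Sum>n\<in>r ` {..<N}. \<bar>g n z\<bar>)"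
      using r(1) by (subst sum.reindex) (auto simp: strict_mono_imp_inj_on)
    also have "\<dots> \<le> (\<Sum>n<r N. \<bar>g n z\<bar>)"
      using strict_monoD[OF r(1)] by (intro sum_mono2) auto
    also have "\<dots> \<le> C * norm z" by (rule sum_g)
    finally show "(\<Sum>n<N. \<bar>(g \<circ> r) n z\<bar>) \<le> C * norm z" .
  qed (use r y g \<epsilon> in auto)
qed


section \<open>Disjoint sequences in solid hulls are weakly null\<close>

text \<open>
  The Riesz decomposition for elements without sign. Truncating \<open>u\<^sup>+\<close> and \<open>u\<^sup>-\<close> separately at \<open>a\<close>
  keeps both pieces below \<open>\<bar>u\<bar>\<close> as well.
\<close>

lemma abs_le_add_decomp:
  fixes u a c :: "'a::banach_lattice"
  assumes u: "\<bar>u\<bar> \<le> a + c" and "0 \<le> a" "0 \<le> c"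
  obtains u1 u2 where "u = u1 + u2" "\<bar>u1\<bar> \<le> a" "\<bar>u1\<bar> \<le> \<bar>u\<bar>" "\<bar>u2\<bar> \<le> c" "\<bar>u2\<bar> \<le> \<bar>u\<bar>"
proof -
  define p n where "p = pprt u" and "n = pprt (- u)"
  have pn: "0 \<le> p" "0 \<le> n" "p \<le> \<bar>u\<bar>" "n \<le> \<bar>u\<bar>"
    using pprt_le_abs[of u] pprt_le_abs[of "- u"] by (simp_all add: p_def n_def)
  have eq: "u = p - n" using prts[of u] by (simp add: p_def n_def pprt_neg)
  have c: "b - inf b a \<le> c" "0 \<le> b - inf b a" "b - inf b a \<le> b" if "0 \<le> b" "b \<le> \<bar>u\<bar>" for b
  proof -
    have "b - a \<le> c" using order_trans[OF that(2) u] by (simp add: algebra_simps)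
    then show "b - inf b a \<le> c" using \<open>0 \<le> c\<close> unfolding diff_inf_eq_pprt by (simp add: pprt_def)
    show "0 \<le> b - inf b a" by (simp only: diff_inf_eq_pprt zero_le_pprt)
    show "b - inf b a \<le> b" using that(1) \<open>0 \<le> a\<close> unfolding diff_inf_eq_pprt by (simp add: pprt_def)
  qed
  show ?thesis
  proof (rule that)
    have "p - n = (b - b') + ((p - b) - (n - b'))" for b b' by simp
    then show "u = (inf p a - inf n a) + ((p - inf p a) - (n - inf n a))" by (simp only: eq)
    show "\<bar>inf p a - inf n a\<bar> \<le> a" "\<bar>inf p a - inf n a\<bar> \<le> \<bar>u\<bar>"
      by (intro abs_diff_le; use pn \<open>0 \<le> a\<close> in \<open>auto intro: le_infI1\<close>)+
    show "\<bar>(p - inf p a) - (n - inf n a)\<bar> \<le> c"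
      using pn by (intro abs_diff_le c) auto
    show "\<bar>(p - inf p a) - (n - inf n a)\<bar> \<le> \<bar>u\<bar>"
      using pn by (intro abs_diff_le c order_trans[OF c(3)]) auto
  qed
qed

text \<open>
  The value at \<open>\<bar>z\<bar>\<close> of the component of the modulus \<open>\<bar>h\<bar>\<close> carried by the band of \<open>e\<close>. Using the
  supremum itself avoids constructing \<open>\<bar>h\<bar>\<close> as a functional: sublinearity in \<open>z\<close> and superadditivity
  over disjoint \<open>e\<close> suffice.
\<close>

definition band_component :: "('a::banach_lattice \<Rightarrow> real) \<Rightarrow> 'a \<Rightarrow> 'a \<Rightarrow> real" where
  "band_component h e z = (SUP u\<in>{u. \<bar>u\<bar> \<le> \<bar>z\<bar> \<and> (\<exists>t\<ge>0. \<bar>u\<bar> \<le> t *\<^sub>R \<bar>e\<bar>)}. h u)"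

context
  fixes h :: "'a::banach_lattice \<Rightarrow> real" and K :: real
  assumes lin: "linear h" and K: "\<And>u. h u \<le> K * norm u" "0 \<le> K"
begin

lemma functional_le_norm:
  assumes "\<bar>u\<bar> \<le> \<bar>z\<bar>"
  shows "h u \<le> K * norm z"
  using K(1)[of u] mult_left_mono[OF norm_mono_abs[OF assms] K(2)] by linarith

lemma bdd_above_band_component:
  "bdd_above (h ` {u. \<bar>u\<bar> \<le> \<bar>z\<bar> \<and> (\<exists>t\<ge>0. \<bar>u\<bar> \<le> t *\<^sub>R \<bar>e\<bar>)})"
  by (rule bdd_aboveI2[of _ _ "K * norm z"]) (auto intro: functional_le_norm)

lemma band_component_upper:
  assumes "\<bar>u\<bar> \<le> \<bar>z\<bar>" "0 \<le> t" "\<bar>u\<bar> \<le> t *\<^sub>R \<bar>e\<bar>"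
  shows "h u \<le> band_component h e z"
  unfolding band_component_def using assms by (intro cSUP_upper bdd_above_band_component) auto

lemma band_component_least:
  assumes "\<And>u t. \<bar>u\<bar> \<le> \<bar>z\<bar> \<Longrightarrow> 0 \<le> t \<Longrightarrow> \<bar>u\<bar> \<le> t *\<^sub>R \<bar>e\<bar> \<Longrightarrow> h u \<le> a"
  shows "band_component h e z \<le> a"
  unfolding band_component_def
proof (rule cSUP_least)
  have "0 \<in> {u. \<bar>u\<bar> \<le> \<bar>z\<bar> \<and> (\<exists>t\<ge>0. \<bar>u\<bar> \<le> t *\<^sub>R \<bar>e\<bar>)}" by (auto intro: exI[of _ 0])
  then show "{u. \<bar>u\<bar> \<le> \<bar>z\<bar> \<and> (\<exists>t\<ge>0. \<bar>u\<bar> \<le> t *\<^sub>R \<bar>e\<bar>)} \<noteq> {}" by blast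
qed (use assms in auto)

lemma band_component_approx:
  assumes "0 < \<eta>"
  obtains u t where "\<bar>u\<bar> \<le> \<bar>z\<bar>" "0 \<le> t" "\<bar>u\<bar> \<le> t *\<^sub>R \<bar>e\<bar>" "band_component h e z \<le> h u + \<eta>"
proof (rule ccontr)
  assume "\<not> thesis"
  then have "band_component h e z \<le> band_component h e z - \<eta>"
    using that by (intro band_component_least) (meson le_diff_eq linear)
  with assms show False by simp
qed

lemma band_component_le_norm: "band_component h e z \<le> K * norm z"
  by (rule band_component_least) (rule functional_le_norm)

lemma sublinear_band_component: "sublinear (band_component h e)"
proof (rule sublinearI)
  fix x y
  show "band_component h e (x + y) \<le> band_component h e x + band_component h e y"
  proof (rule band_component_least)
    fix u t assume u: "\<bar>u\<bar> \<le> \<bar>x + y\<bar>" "0 \<le> t" "\<bar>u\<bar> \<le> t *\<^sub>R \<bar>e\<bar>"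
    have "\<bar>u\<bar> \<le> \<bar>x\<bar> + \<bar>y\<bar>" by (rule order_trans[OF u(1) abs_triangle_ineq])
    then obtain u1 u2 where d: "u = u1 + u2" "\<bar>u1\<bar> \<le> \<bar>x\<bar>" "\<bar>u1\<bar> \<le> \<bar>u\<bar>" "\<bar>u2\<bar> \<le> \<bar>y\<bar>" "\<bar>u2\<bar> \<le> \<bar>u\<bar>"
      using abs_le_add_decomp[of u "\<bar>x\<bar>" "\<bar>y\<bar>"] by (metis abs_ge_zero)
    have "h u = h u1 + h u2" unfolding d(1) by (rule linear_add[OF lin])
    also have "\<dots> \<le> band_component h e x + band_component h e y"
      using d u by (intro add_mono band_component_upper[of _ _ t]) (auto intro: order_trans)
    finally show "h u \<le> band_component h e x + band_component h e y" .
  qed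
next
  have "h 0 \<le> band_component h e 0" by (rule band_component_upper[of _ _ 0]) auto
  then show "band_component h e 0 = 0"
    using band_component_le_norm[of e 0] linear_0[OF lin] by simp
next
  fix c :: real and x assume c: "0 < c"
  show "band_component h e (c *\<^sub>R x) \<le> c * band_component h e x"
  proof (rule band_component_least)
    fix u t assume u: "\<bar>u\<bar> \<le> \<bar>c *\<^sub>R x\<bar>" "0 \<le> t" "\<bar>u\<bar> \<le> t *\<^sub>R \<bar>e\<bar>"
    have "h (inverse c *\<^sub>R u) \<le> band_component h e x"
    proof (rule band_component_upper)
      have le: "\<bar>inverse c *\<^sub>R u\<bar> \<le> inverse c *\<^sub>R b" if "\<bar>u\<bar> \<le> b" for b
        using that c by (simp add: abs_scaleR_lattice scaleR_left_mono)
      show "\<bar>inverse c *\<^sub>R u\<bar> \<le> \<bar>x\<bar>"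
        using le[OF u(1)] c by (simp add: abs_scaleR_lattice)
      show "\<bar>inverse c *\<^sub>R u\<bar> \<le> (inverse c * t) *\<^sub>R \<bar>e\<bar>"
        using le[OF u(3)] by simp
      show "0 \<le> inverse c * t" using c u by simp
    qed
    then show "h u \<le> c * band_component h e x"
      using c by (simp add: linear_scale[OF lin] field_simps)
  qed
qed

text \<open>
  Competitors \<open>u\<^sub>n\<close> for disjoint \<open>x\<^sub>n\<close> are disjoint and bounded by \<open>\<bar>z\<bar>\<close>, so the modulus of their
  sum is at most \<open>\<bar>z\<bar>\<close>, and \<open>\<Sum> h(u\<^sub>n) = h(\<Sum> u\<^sub>n)\<close> is at most \<open>K \<parallel>z\<parallel>\<close>.
\<close>

lemma sum_band_component_le:
  assumes x: "disjoint_seq x"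
  shows "(\<Sum>n<N. band_component h (x n) z) \<le> K * norm z"
proof (rule field_le_epsilon)
  fix \<epsilon> :: real assume \<epsilon>: "0 < \<epsilon>"
  define \<eta> where "\<eta> = \<epsilon> / real (Suc N)"
  have "0 < \<eta>" using \<epsilon> by (simp add: \<eta>_def)
  then have "\<forall>n. \<exists>u t. \<bar>u\<bar> \<le> \<bar>z\<bar> \<and> 0 \<le> t \<and> \<bar>u\<bar> \<le> t *\<^sub>R \<bar>x n\<bar> \<and> band_component h (x n) z \<le> h u + \<eta>"
    using band_component_approx by metis
  then obtain u t where u: "\<And>n. \<bar>u n\<bar> \<le> \<bar>z\<bar>" "\<And>n. 0 \<le> t n" "\<And>n. \<bar>u n\<bar> \<le> t n *\<^sub>R \<bar>x n\<bar>"
      "\<And>n. band_component h (x n) z \<le> h (u n) + \<eta>"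
    by metis
  have disj: "inf \<bar>u m\<bar> \<bar>u n\<bar> = 0" if "m \<noteq> n" for m n
  proof (rule disjoint_mono[OF _ _ _ u(3) u(3)])
    have "inf \<bar>x n\<bar> \<bar>x m\<bar> = 0" using x that by (simp add: disjoint_seq_def)
    then have "inf (t m *\<^sub>R \<bar>x m\<bar>) \<bar>x n\<bar> = 0"
      using disjoint_scaleR[of "\<bar>x n\<bar>" "\<bar>x m\<bar>" "t m"] u(2) by (simp add: inf_commute)
    then show "inf (t m *\<^sub>R \<bar>x m\<bar>) (t n *\<^sub>R \<bar>x n\<bar>) = 0" using u(2) by (rule disjoint_scaleR)
  qed auto
  have "(\<Sum>n<N. \<bar>u n\<bar>) \<le> \<bar>z\<bar>"
    using u(1) disj by (intro sum_disjoint_le) auto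
  then have "\<bar>\<Sum>n<N. u n\<bar> \<le> \<bar>z\<bar>" by (rule order_trans[OF sum_abs])
  then have "h (\<Sum>n<N. u n) \<le> K * norm z" by (rule functional_le_norm)
  moreover have "(\<Sum>n<N. band_component h (x n) z) \<le> (\<Sum>n<N. h (u n) + \<eta>)"
    using u(4) by (intro sum_mono)
  moreover have "(\<Sum>n<N. h (u n) + \<eta>) = h (\<Sum>n<N. u n) + real N * \<eta>"
    by (simp add: sum.distrib linear_sum[OF lin])
  moreover have "real N * \<eta> \<le> \<epsilon>" using \<epsilon> by (simp add: \<eta>_def field_simps)
  ultimately show "(\<Sum>n<N. band_component h (x n) z) \<le> K * norm z + \<epsilon>" by linarith
qed

end

text \<open>
  Choose \<open>y\<^sub>n \<in> A\<close> with \<open>\<bar>x\<^sub>n\<bar> \<le> \<bar>y\<^sub>n\<bar>\<close>. The Hahn-Banach theorem gives a linear \<open>g\<^sub>n\<close> that is dominated by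
  the component of \<open>\<bar>h\<bar>\<close> carried by \<open>x\<^sub>n\<close> and attains it at \<open>y\<^sub>n\<close>. Then \<open>\<bar>h(x\<^sub>n)\<bar> \<le> g\<^sub>n(y\<^sub>n)\<close>, while
  disjointness makes the \<open>g\<^sub>n\<close> absolutely summable at every point, so \<open>g\<^sub>n(y\<^sub>n)\<close> tends to \<open>0\<close>.
\<close>

lemma disjoint_seq_weakly_null:
  fixes A :: "'a::banach_lattice set"
  assumes A: "relatively_weakly_compact A" and x: "disjoint_seq x" "\<And>n. \<exists>a\<in>A. \<bar>x n\<bar> \<le> \<bar>a\<bar>"
  shows "weakly_null x"
  unfolding weakly_null_def
proof (intro allI impI)
  fix h :: "'a \<Rightarrow> real" assume h: "bounded_linear h"
  then have lin: "linear h" by (rule bounded_linear.linear)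
  obtain K where K0: "0 \<le> K" "\<And>u. norm (h u) \<le> norm u * K"
    using bounded_linear.nonneg_bounded[OF h] by blast
  have K: "h u \<le> K * norm u" for u using K0(2)[of u] by (simp add: mult.commute)
  from x(2) obtain y where y: "\<And>n. y n \<in> A" "\<And>n. \<bar>x n\<bar> \<le> \<bar>y n\<bar>" by metis
  have "\<exists>g. linear g \<and> (\<forall>z. g z \<le> band_component h (x n) z) \<and> g (y n) = band_component h (x n) (y n)" for n
    using hahn_banach_sublinear[OF sublinear_band_component[OF lin K K0(1)], of "x n" "y n"] by metis
  then obtain g where g: "\<And>n. linear (g n)" "\<And>n z. g n z \<le> band_component h (x n) z"
      "\<And>n. g n (y n) = band_component h (x n) (y n)"
    by metis
  have g_abs: "\<bar>g n z\<bar> \<le> band_component h (x n) z" for n z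
    using g(2)[of n z] g(2)[of n "- z"] linear_neg[OF g(1), of n z]
    by (simp add: band_component_def)
  have "(\<lambda>n. g n (y n)) \<longlonglongrightarrow> 0"
  proof (rule tendsto_on_relatively_weakly_compact[OF A y(1)])
    fix n show "bounded_linear (g n)"
      using g(1) order_trans[OF g(2) band_component_le_norm[OF lin K K0(1)]]
      by (rule bounded_linear_if_le_norm)
  next
    fix N z
    show "(\<Sum>n<N. \<bar>g n z\<bar>) \<le> K * norm z"
      using sum_mono[OF g_abs] sum_band_component_le[OF lin K K0(1) x(1)] by (rule order_trans)
  qed
  moreover have "norm (h (x n)) \<le> g n (y n)" for n
  proof -
    have "h u \<le> g n (y n)" if "\<bar>u\<bar> = \<bar>x n\<bar>" for u
      unfolding g(3) using y(2) that by (intro band_component_upper[OF lin K K0(1), of _ _ 1]) auto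
    from this[of "x n"] this[of "- x n"] show ?thesis
      using linear_neg[OF lin, of "x n"] by simp
  qed
  ultimately show "(\<lambda>n. h (x n)) \<longlonglongrightarrow> 0"
    by (intro Lim_null_comparison[of "\<lambda>n. h (x n)" "\<lambda>n. g n (y n)"]) auto
qed

section \<open>Disjointification\<close>

text \<open>
  Put \<open>s = \<Sum> 2\<^sup>-\<^sup>i x\<^sub>i\<close> and \<open>u\<^sub>n = (x\<^sub>n - v\<^sub>n - 2\<^sup>-\<^sup>n s)\<^sup>+\<close>. For \<open>n < m\<close>, the bounds \<open>x\<^sub>m \<le> 2\<^sup>m s\<close> and
  \<open>v\<^sub>m \<ge> 4\<^sup>m x\<^sub>n\<close> show that \<open>u\<^sub>m\<close> is below a multiple of \<open>(2\<^sup>-\<^sup>n s - x\<^sub>n)\<^sup>+\<close>, whereas \<open>u\<^sub>n\<close> is below the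
  opposite part \<open>(x\<^sub>n - 2\<^sup>-\<^sup>n s)\<^sup>+\<close>; so the two are disjoint.
\<close>

lemma disjointification:
  fixes x :: "nat \<Rightarrow> 'a::banach_lattice"
  assumes x: "\<And>n. 0 \<le> x n" "\<And>n. norm (x n) \<le> B"
    and v: "\<And>n. 0 \<le> v n" "\<And>i n. i < n \<Longrightarrow> 4 ^ n *\<^sub>R x i \<le> v n"
  obtains u where "disjoint_seq u" "\<And>n. 0 \<le> u n" "\<And>n. u n \<le> x n"
    "(\<lambda>n. pprt (x n - v n) - u n) \<longlonglongrightarrow> 0"
proof -
  define s where "s = (\<Sum>i. (1/2) ^ i *\<^sub>R x i)"
  have "summable (\<lambda>i. (1/2) ^ i *\<^sub>R x i)"
  proof (rule summable_comparison_test')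
    show "summable (\<lambda>i. (1/2) ^ i * B :: real)" by (intro summable_mult2 summable_geometric) simp
    show "norm ((1/2) ^ i *\<^sub>R x i) \<le> (1/2) ^ i * B" for i
      using x(2)[of i] by simp
  qed
  then have lim: "(\<lambda>n. \<Sum>i<n. (1/2) ^ i *\<^sub>R x i) \<longlonglongrightarrow> s"
    unfolding s_def by (rule summable_LIMSEQ)
  have term_le: "(1/2) ^ n *\<^sub>R x n \<le> s" for n
  proof -
    have "0 \<le> s - (1/2) ^ n *\<^sub>R x n"
    proof (rule nonneg_LIMSEQ[of _ _ "Suc n"])
      show "(\<lambda>m. (\<Sum>i<m. (1/2) ^ i *\<^sub>R x i) - (1/2) ^ n *\<^sub>R x n) \<longlonglongrightarrow> s - (1/2) ^ n *\<^sub>R x n"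
        using lim by (intro tendsto_intros)
      fix m assume "Suc n \<le> m"
      then have "(\<Sum>i\<in>{n}. (1/2) ^ i *\<^sub>R x i) \<le> (\<Sum>i<m. (1/2) ^ i *\<^sub>R x i)"
        using x(1) by (intro sum_mono2) (auto intro: scaleR_nonneg_nonneg)
      then show "0 \<le> (\<Sum>i<m. (1/2) ^ i *\<^sub>R x i) - (1/2) ^ n *\<^sub>R x n" by simp
    qed
    then show ?thesis by simp
  qed
  have s0: "0 \<le> s" using term_le[of 0] x(1)[of 0] by simp
  define u where "u n = pprt (x n - v n - (1/2) ^ n *\<^sub>R s)" for n
  have u0: "0 \<le> u n" for n by (simp add: u_def)
  have disj: "inf (u n) (u m) = 0" if "n < m" for n m
  proof -
    have a: "u n \<le> pprt (x n - (1/2) ^ n *\<^sub>R s)"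
      unfolding u_def using v(1)[of n] by (intro pprt_mono) (simp add: algebra_simps)
    have "x m \<le> 2 ^ m *\<^sub>R s"
      using scaleR_left_mono[OF term_le[of m], of "2 ^ m"] by (simp add: power_one_over)
    also have "\<dots> \<le> 4 ^ m *\<^sub>R ((1/2) ^ n *\<^sub>R s)"
    proof -
      have "(2::real) ^ m * 2 ^ n \<le> 2 ^ m * 2 ^ m"
        using that by (intro mult_left_mono power_increasing) auto
      also have "\<dots> = 4 ^ m" by (simp flip: power_mult_distrib)
      finally have "(2::real) ^ m \<le> 4 ^ m * (1/2) ^ n" by (simp add: field_simps power_one_over)
      then show ?thesis using s0 by (simp add: scaleR_right_mono)
    qed
    finally have "x m - v m - (1/2) ^ m *\<^sub>R s \<le> 4 ^ m *\<^sub>R ((1/2) ^ n *\<^sub>R s) - 4 ^ m *\<^sub>R x n - 0"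
      using v(2)[OF that] s0 by (intro diff_mono) (auto intro: scaleR_nonneg_nonneg)
    then have "u m \<le> pprt (4 ^ m *\<^sub>R (- (x n - (1/2) ^ n *\<^sub>R s)))"
      unfolding u_def by (intro pprt_mono) (simp add: algebra_simps)
    also have "\<dots> = 4 ^ m *\<^sub>R pprt (- (x n - (1/2) ^ n *\<^sub>R s))" by (intro pprt_scaleR) simp
    finally have b: "u m \<le> 4 ^ m *\<^sub>R pprt (- (x n - (1/2) ^ n *\<^sub>R s))" .
    show ?thesis
      by (rule disjoint_mono[OF disjoint_scaleR[OF disjoint_pprt] u0 u0 a b]) simp
  qed
  show ?thesis
  proof (rule that)
    show "disjoint_seq u"
      unfolding disjoint_seq_def
    proof (intro allI impI)
      fix m n :: nat assume "m \<noteq> n"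
      then show "inf \<bar>u m\<bar> \<bar>u n\<bar> = 0"
        using disj[of m n] disj[of n m] u0 by (cases "m < n") (auto simp: inf_commute)
    qed
    show "0 \<le> u n" for n by (rule u0)
    show "u n \<le> x n" for n
    proof -
      have "x n - v n - (1/2) ^ n *\<^sub>R s \<le> x n - 0 - 0"
        using v(1)[of n] s0 by (intro diff_mono) (auto intro: scaleR_nonneg_nonneg)
      then show ?thesis using x(1) by (simp add: u_def pprt_def)
    qed
    show "(\<lambda>n. pprt (x n - v n) - u n) \<longlonglongrightarrow> 0"
    proof (rule Lim_null_comparison)
      show "\<forall>\<^sub>F n in sequentially. norm (pprt (x n - v n) - u n) \<le> (1/2) ^ n * norm s"
      proof (intro always_eventually allI)
        fix n
        define c where "c = (1/2) ^ n *\<^sub>R s"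
        have c: "0 \<le> c" using s0 by (simp add: c_def scaleR_nonneg_nonneg)
        have "0 \<le> pprt (x n - v n) - u n"
          unfolding u_def c_def[symmetric] using c by (simp add: pprt_mono)
        moreover have "pprt (x n - v n) - u n \<le> c"
          using pprt_add_le[of "x n - v n - c" c] c by (simp add: u_def c_def[symmetric] diff_le_eq add.commute)
        ultimately have "norm (pprt (x n - v n) - u n) \<le> norm c" by (rule norm_mono_nonneg)
        then show "norm (pprt (x n - v n) - u n) \<le> (1/2) ^ n * norm s" by (simp add: c_def)
      qed
      show "(\<lambda>n. (1/2) ^ n * norm s) \<longlonglongrightarrow> 0"
        by (intro tendsto_mult_left_zero LIMSEQ_power_zero) simp
    qed
  qed
qed

text \<open>
  Otherwise one chooses \<open>x\<^sub>n \<in> A\<close> one after the other such that \<open>T\<close> stays at least \<open>\<epsilon>\<close> in norm on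
  \<open>(x\<^sub>n - v\<^sub>n)\<^sup>+\<close>, where \<open>v\<^sub>n\<close> is \<open>4\<^sup>n\<close> times the sum of the earlier choices. These positive parts are
  norm close to a disjoint sequence below \<open>A\<close>, on which \<open>T\<close> tends to \<open>0\<close>.
\<close>

lemma approximate_order_bound:
  fixes T :: "'a::banach_lattice \<Rightarrow> 'b::real_normed_vector"
  assumes T: "bounded_linear T" and A: "bounded A" "\<And>a. a \<in> A \<Longrightarrow> 0 \<le> a"
    and null: "\<And>u. disjoint_seq u \<Longrightarrow> (\<And>n. 0 \<le> u n) \<Longrightarrow> (\<And>n. \<exists>a\<in>A. u n \<le> a) \<Longrightarrow>
      (\<lambda>n. T (u n)) \<longlonglongrightarrow> 0"
    and \<epsilon>: "0 < \<epsilon>"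
  obtains S K where "finite S" "S \<subseteq> A" "0 \<le> K"
    "\<And>a. a \<in> A \<Longrightarrow> norm (T (pprt (a - K *\<^sub>R \<Sum>S))) < \<epsilon>"
proof (rule ccontr)
  note small = that
  assume contr: "\<not> thesis"
  have ex: "\<exists>a\<in>A. \<epsilon> \<le> norm (T (pprt (a - K *\<^sub>R \<Sum>S)))" if "finite S" "S \<subseteq> A" "0 \<le> K" for S K
  proof (rule ccontr)
    assume "\<not> ?thesis"
    then have "norm (T (pprt (a - K *\<^sub>R \<Sum>S))) < \<epsilon>" if "a \<in> A" for a using that by force
    then have thesis by (rule small[OF that])
    with contr show False ..
  qed
  \<comment> \<open>A state of the recursion consists of the set of earlier choices and the current choice.\<close>
  have "\<exists>p. \<forall>n. (finite (fst (p n)) \<and> fst (p n) \<subseteq> A \<and> snd (p n) \<in> A \<and>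
      \<epsilon> \<le> norm (T (pprt (snd (p n) - 4 ^ n *\<^sub>R \<Sum>(fst (p n)))))) \<and>
      fst (p (Suc n)) = insert (snd (p n)) (fst (p n))"
  proof (rule dependent_nat_choice)
    obtain a where "a \<in> A" "\<epsilon> \<le> norm (T (pprt (a - 4 ^ 0 *\<^sub>R \<Sum>{})))"
      using ex[of "{}" "4 ^ 0"] by auto
    then show "\<exists>p. finite (fst p) \<and> fst p \<subseteq> A \<and> snd p \<in> A \<and>
        \<epsilon> \<le> norm (T (pprt (snd p - 4 ^ 0 *\<^sub>R \<Sum>(fst p))))"
      by (intro exI[of _ "({}, a)"]) simp
  next
    fix p :: "'a set \<times> 'a" and n
    assume p: "finite (fst p) \<and> fst p \<subseteq> A \<and> snd p \<in> A \<and>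
      \<epsilon> \<le> norm (T (pprt (snd p - 4 ^ n *\<^sub>R \<Sum>(fst p))))"
    then obtain a where "a \<in> A"
        "\<epsilon> \<le> norm (T (pprt (a - 4 ^ Suc n *\<^sub>R \<Sum>(insert (snd p) (fst p)))))"
      using ex[of "insert (snd p) (fst p)" "4 ^ Suc n"] by auto
    with p show "\<exists>p'. (finite (fst p') \<and> fst p' \<subseteq> A \<and> snd p' \<in> A \<and>
        \<epsilon> \<le> norm (T (pprt (snd p' - 4 ^ Suc n *\<^sub>R \<Sum>(fst p'))))) \<and>
        fst p' = insert (snd p) (fst p)"
      by (intro exI[of _ "(insert (snd p) (fst p), a)"]) simp
  qed
  then obtain p where p: "\<And>n. finite (fst (p n))" "\<And>n. fst (p n) \<subseteq> A" "\<And>n. snd (p n) \<in> A"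
      "\<And>n. \<epsilon> \<le> norm (T (pprt (snd (p n) - 4 ^ n *\<^sub>R \<Sum>(fst (p n)))))"
      "\<And>n. fst (p (Suc n)) = insert (snd (p n)) (fst (p n))"
    by blast
  define x where "x n = snd (p n)" for n
  define v where "v n = 4 ^ n *\<^sub>R \<Sum>(fst (p n))" for n
  have in_S: "x i \<in> fst (p n)" if "i < n" for i n
    using that by (induction n) (auto simp: p(5) x_def less_Suc_eq)
  have x0: "0 \<le> x n" for n using A(2) p(3) by (simp add: x_def)
  have v0: "0 \<le> v n" for n
    unfolding v_def using A(2) p(2) by (intro scaleR_nonneg_nonneg sum_nonneg) auto
  have xv: "4 ^ n *\<^sub>R x i \<le> v n" if "i < n" for i n
  proof -
    have "x i \<le> \<Sum>(fst (p n))"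
      using sum_mono2[of "fst (p n)" "{x i}" "\<lambda>a. a"] in_S[OF that] p(1,2)[of n] A(2)
      by (simp add: subset_iff)
    then show ?thesis unfolding v_def by (intro scaleR_left_mono) auto
  qed
  obtain B where B: "\<And>a. a \<in> A \<Longrightarrow> norm a \<le> B" using A(1) by (auto simp: bounded_iff)
  obtain u where u: "disjoint_seq u" "\<And>n. 0 \<le> u n" "\<And>n. u n \<le> x n"
      "(\<lambda>n. pprt (x n - v n) - u n) \<longlonglongrightarrow> 0"
    using disjointification[of x B v] x0 v0 xv B p(3) by (auto simp: x_def)
  have "(\<lambda>n. T (u n)) \<longlonglongrightarrow> 0"
    using u(3) p(3) by (intro null u(1,2)) (auto simp: x_def)
  moreover have "(\<lambda>n. T (pprt (x n - v n) - u n)) \<longlonglongrightarrow> 0"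
    using bounded_linear.tendsto_zero[OF T u(4)] .
  ultimately have "(\<lambda>n. T (pprt (x n - v n) - u n) + T (u n)) \<longlonglongrightarrow> 0 + 0"
    by (intro tendsto_add)
  then have "(\<lambda>n. T (pprt (x n - v n))) \<longlonglongrightarrow> 0"
    by (simp add: linear_add[OF bounded_linear.linear[OF T], symmetric])
  then have "\<forall>\<^sub>F n in sequentially. norm (T (pprt (x n - v n))) < \<epsilon>"
    using \<epsilon> by (intro order_tendstoD(2)[OF tendsto_norm_zero])
  then obtain n where "norm (T (pprt (x n - v n))) < \<epsilon>"
    by (auto simp: eventually_sequentially)
  with p(4)[of n] show False by (simp add: x_def v_def)
qed


section \<open>Order continuity of the norm\<close>

lemma archimedean_lattice:
  fixes w :: "'a::banach_lattice"
  assumes "0 \<le> w" "\<And>k::nat. real k *\<^sub>R w \<le> z"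
  shows "w = 0"
proof (rule ccontr)
  assume "w \<noteq> 0"
  then obtain k :: nat where k: "norm z / norm w < real k" using reals_Archimedean2 by blast
  have "norm (real k *\<^sub>R w) \<le> norm z"
    using assms by (intro norm_mono_nonneg scaleR_nonneg_nonneg) auto
  with k \<open>w \<noteq> 0\<close> show False by (simp add: field_simps)
qed

text \<open>
  Upper bounds \<open>z\<close> of the partial sums \<open>s\<^sub>n\<close> replace their supremum, which need not exist. The
  infimum of all \<open>z - s\<^sub>n\<close> is \<open>0\<close>: a positive lower bound could be subtracted from \<open>u\<close> again and again
  without losing the property of being an upper bound, contradicting the Archimedean property.
\<close>

lemma order_continuous_norm_imp_disjoint_null:
  fixes v :: "nat \<Rightarrow> 'f::banach_lattice"
  assumes oc: "order_continuous_norm TYPE('f)"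
    and v: "disjoint_seq v" "\<And>n. 0 \<le> v n" "\<And>n. v n \<le> u"
  shows "v \<longlonglongrightarrow> 0"
proof -
  define s where "s n = (\<Sum>i<n. v i)" for n :: nat
  define U where "U = {z. \<forall>n. s n \<le> z}"
  define I where "I = U \<times> (UNIV :: nat set)"
  define r :: "'f \<times> nat \<Rightarrow> 'f \<times> nat \<Rightarrow> bool"
    where "r p q \<longleftrightarrow> fst q \<le> fst p \<and> snd p \<le> snd q" for p q
  have s_mono: "s m \<le> s n" if "m \<le> n" for m n
    unfolding s_def using that v(2) by (intro sum_mono2) auto
  have "0 \<le> u" using order_trans[OF v(2) v(3)] .
  then have "s n \<le> u" for n
    unfolding s_def using v by (intro sum_disjoint_le) (auto simp: disjoint_seq_def)
  then have u: "u \<in> U" by (simp add: U_def)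
  have dir: "directed_index I r"
    unfolding directed_index_def
  proof (intro conjI ballI impI)
    show "I \<noteq> {}" using u by (auto simp: I_def)
    fix p q assume "p \<in> I" "q \<in> I"
    then have "(inf (fst p) (fst q), max (snd p) (snd q)) \<in> I" by (auto simp: I_def U_def)
    then show "\<exists>k\<in>I. r p k \<and> r q k" by (rule rev_bexI) (simp add: r_def)
  qed (auto simp: r_def)
  have "net_decreases_to I r (\<lambda>p. fst p - s (snd p)) 0"
    unfolding net_decreases_to_def
  proof (intro conjI ballI impI allI)
    fix p q assume "r p q"
    then show "fst q - s (snd q) \<le> fst p - s (snd p)"
      unfolding r_def using s_mono by (intro diff_mono) auto
  next
    fix p assume "p \<in> I"
    then show "0 \<le> fst p - s (snd p)" by (auto simp: I_def U_def)
  next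
    fix w assume w: "\<forall>p\<in>I. w \<le> fst p - s (snd p)"
    have step: "z - pprt w \<in> U" if "z \<in> U" for z
    proof -
      have "pprt w \<le> z - s n" for n
        using w that by (auto simp: pprt_def I_def U_def)
      then show ?thesis by (auto simp: U_def algebra_simps)
    qed
    have "u - real k *\<^sub>R pprt w \<in> U" for k
    proof (induction k)
      case (Suc k)
      have "u - real (Suc k) *\<^sub>R pprt w = (u - real k *\<^sub>R pprt w) - pprt w"
        by (simp add: algebra_simps)
      then show ?case using step[OF Suc] by (simp only:)
    qed (use u in simp)
    then have "s 0 \<le> u - real k *\<^sub>R pprt w" for k by (simp add: U_def)
    then have "pprt w = 0"
      by (intro archimedean_lattice[of "pprt w" u]) (simp_all add: s_def)
    then show "w \<le> 0" using le_pprt[of w] by simp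
  qed
  then have net: "net_decreases_to I r (\<lambda>p. norm (fst p - s (snd p))) 0"
    by (rule order_continuous_norm_net[OF oc dir])
  show ?thesis
  proof (rule LIMSEQ_I)
    fix \<epsilon> :: real assume "0 < \<epsilon>"
    then obtain p where p: "p \<in> I" "norm (fst p - s (snd p)) < \<epsilon>"
      using net unfolding net_decreases_to_def by (meson not_le)
    have "norm (v m) < \<epsilon>" if "snd p \<le> m" for m
    proof -
      have "v m = s (Suc m) - s m" by (simp add: s_def)
      also have "\<dots> \<le> fst p - s (snd p)"
        using p(1) s_mono[OF that] by (intro diff_mono) (auto simp: I_def U_def)
      finally show ?thesis using norm_mono_nonneg[OF v(2)] p(2) by fastforce
    qed
    then show "\<exists>no. \<forall>n\<ge>no. norm (v n - 0) < \<epsilon>" by auto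
  qed
qed

lemma inf_scaleR_tendsto_0:
  fixes f :: "nat \<Rightarrow> 'a::banach_lattice"
  assumes "\<And>n. 0 \<le> f n" "0 \<le> b" "0 \<le> c" "(\<lambda>n. inf (f n) b) \<longlonglongrightarrow> 0"
  shows "(\<lambda>n. inf (f n) (c *\<^sub>R b)) \<longlonglongrightarrow> 0"
proof (rule Lim_null_comparison)
  show "\<forall>\<^sub>F n in sequentially. norm (inf (f n) (c *\<^sub>R b)) \<le> norm (max 1 c *\<^sub>R inf (f n) b)"
    using assms
    by (intro always_eventually allI norm_mono_nonneg inf_scaleR_le le_infI scaleR_nonneg_nonneg)
  show "(\<lambda>n. norm (max 1 c *\<^sub>R inf (f n) b)) \<longlonglongrightarrow> 0"
    using tendsto_scaleR[OF tendsto_const assms(4), of "max 1 c"] by (intro tendsto_norm_zero) simp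
qed

lemma inf_sum_tendsto_0:
  fixes f :: "nat \<Rightarrow> 'a::banach_lattice"
  assumes "finite S" "\<And>n. 0 \<le> f n" "\<And>s. s \<in> S \<Longrightarrow> 0 \<le> s"
    "\<And>s. s \<in> S \<Longrightarrow> (\<lambda>n. inf (f n) s) \<longlonglongrightarrow> 0"
  shows "(\<lambda>n. inf (f n) (\<Sum>S)) \<longlonglongrightarrow> 0"
  using assms(1,3,4)
proof (induction S rule: finite_induct)
  case empty
  then show ?case by (simp add: inf_absorb2 assms(2))
next
  case (insert s S)
  have nn: "0 \<le> s" "0 \<le> \<Sum>S" using insert.prems by (auto intro: sum_nonneg)
  show ?case
  proof (rule Lim_null_comparison)
    show "\<forall>\<^sub>F n in sequentially. norm (inf (f n) (\<Sum>(insert s S))) \<le> norm (inf (f n) s + inf (f n) (\<Sum>S))"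
    proof (intro always_eventually allI norm_mono_nonneg)
      fix n
      show "0 \<le> inf (f n) (\<Sum>(insert s S))"
        using assms(2) nn insert.hyps by simp
      show "inf (f n) (\<Sum>(insert s S)) \<le> inf (f n) s + inf (f n) (\<Sum>S)"
        using inf_add_le[OF assms(2) nn] insert.hyps by simp
    qed
    have "(\<lambda>n. inf (f n) (\<Sum>S)) \<longlonglongrightarrow> 0" using insert.prems by (intro insert.IH) auto
    then have "(\<lambda>n. inf (f n) s + inf (f n) (\<Sum>S)) \<longlonglongrightarrow> 0 + 0"
      using insert.prems(2)[of s] by (intro tendsto_add) auto
    then show "(\<lambda>n. norm (inf (f n) s + inf (f n) (\<Sum>S))) \<longlonglongrightarrow> 0"
      by (intro tendsto_norm_zero) simp
  qed
qed

text \<open>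
  The assumption \<open>mult\<close> says that any \<open>N + 1\<close> of the \<open>f\<^sub>n\<close> have infimum at most \<open>0\<close>. By
  \<open>approximate_order_bound\<close> for the identity, \<open>f\<^sub>n\<close> is within \<open>\<epsilon>/2\<close> of its infimum with a multiple of a
  finite sum of members \<open>f\<^sub>i\<close>. For fixed \<open>i\<close> the sequence \<open>inf (f\<^sub>n) (f\<^sub>i)\<close>, \<open>n > i\<close>, has multiplicity
  smaller by one, so these infima tend to \<open>0\<close> by induction.
\<close>

lemma finite_multiplicity_null:
  fixes x :: "'f::banach_lattice" and f :: "nat \<Rightarrow> 'f"
  assumes dn: "\<And>v. disjoint_seq v \<Longrightarrow> (\<And>n. 0 \<le> v n) \<Longrightarrow> (\<And>n. v n \<le> x) \<Longrightarrow> v \<longlonglongrightarrow> 0"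
    and f: "\<And>n. 0 \<le> f n" "\<And>n. f n \<le> x"
    and mult: "\<And>S w. finite S \<Longrightarrow> card S = Suc N \<Longrightarrow> (\<And>i. i \<in> S \<Longrightarrow> w \<le> f i) \<Longrightarrow> w \<le> 0"
  shows "f \<longlonglongrightarrow> 0"
  using f mult
proof (induction N arbitrary: f)
  case 0
  have "f n \<le> 0" for n using 0(3)[of "{n}" "f n"] by simp
  then have "f = (\<lambda>n. 0)" using 0(1) by (auto intro: antisym)
  then show ?case by simp
next
  case (Suc N)
  have pair: "(\<lambda>n. inf (f n) (f i)) \<longlonglongrightarrow> 0" for i
  proof -
    have "(\<lambda>n. inf (f (n + Suc i)) (f i)) \<longlonglongrightarrow> 0"
    proof (rule Suc.IH)
      fix S w assume S: "finite S" "card S = Suc N" "\<And>n. n \<in> S \<Longrightarrow> w \<le> inf (f (n + Suc i)) (f i)"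
      show "w \<le> 0"
      proof (rule Suc.prems(3)[of "insert i ((\<lambda>n. n + Suc i) ` S)"])
        have "i \<notin> (\<lambda>n. n + Suc i) ` S" by auto
        then show "card (insert i ((\<lambda>n. n + Suc i) ` S)) = Suc (Suc N)"
          using S(1,2) by (simp add: card_image inj_on_def)
        obtain n0 where "n0 \<in> S" using S(2) by fastforce
        then show "w \<le> f j" if "j \<in> insert i ((\<lambda>n. n + Suc i) ` S)" for j
          using that S(3) by auto
      qed (use S in simp)
    qed (use Suc.prems in \<open>auto intro: le_infI1\<close>)
    then show ?thesis by (rule LIMSEQ_offset)
  qed
  have "bounded (range f)"
    unfolding bounded_iff
    by (intro exI[of _ "norm x"]) (auto intro: norm_mono_nonneg Suc.prems)
  show ?case
  proof (rule LIMSEQ_I)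
    fix \<epsilon> :: real assume \<epsilon>: "0 < \<epsilon>"
    obtain S K where S: "finite S" "S \<subseteq> range f" "0 \<le> K"
        "\<And>a. a \<in> range f \<Longrightarrow> norm (pprt (a - K *\<^sub>R \<Sum>S)) < \<epsilon> / 2"
    proof (rule approximate_order_bound[of "\<lambda>a :: 'f. a" "range f" "\<epsilon> / 2"])
      show "bounded_linear (\<lambda>a :: 'f. a)" by (rule bounded_linear_ident)
      fix v assume v: "disjoint_seq v" "\<And>n. 0 \<le> v n" "\<And>n. \<exists>a\<in>range f. v n \<le> a"
      show "v \<longlonglongrightarrow> 0"
      proof (rule dn[OF v(1,2)])
        fix n
        obtain i where "v n \<le> f i" using v(3) by blast
        then show "v n \<le> x" using Suc.prems(2) by (rule order_trans)
      qed
    qed (use \<open>bounded (range f)\<close> \<epsilon> Suc.prems in auto)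
    have S0: "0 \<le> s" if "s \<in> S" for s using that S(2) Suc.prems(1) by auto
    have "(\<lambda>n. inf (f n) (\<Sum>S)) \<longlonglongrightarrow> 0"
    proof (rule inf_sum_tendsto_0)
      fix s assume "s \<in> S"
      then show "(\<lambda>n. inf (f n) s) \<longlonglongrightarrow> 0" using S(2) pair by auto
    qed (use S S0 Suc.prems in auto)
    then have "(\<lambda>n. inf (f n) (K *\<^sub>R \<Sum>S)) \<longlonglongrightarrow> 0"
      using S S0 Suc.prems by (intro inf_scaleR_tendsto_0) (auto intro: sum_nonneg)
    from LIMSEQ_D[OF this, of "\<epsilon> / 2"] \<epsilon> obtain n0
      where n0: "\<And>n. n \<ge> n0 \<Longrightarrow> norm (inf (f n) (K *\<^sub>R \<Sum>S)) < \<epsilon> / 2" by auto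
    have "norm (f n) < \<epsilon>" if "n \<ge> n0" for n
    proof -
      have "f n = pprt (f n - K *\<^sub>R \<Sum>S) + inf (f n) (K *\<^sub>R \<Sum>S)"
        by (rule pprt_diff_add_inf[symmetric])
      then have "norm (f n) \<le> norm (pprt (f n - K *\<^sub>R \<Sum>S)) + norm (inf (f n) (K *\<^sub>R \<Sum>S))"
        by (metis norm_triangle_ineq)
      then show ?thesis using S(4)[of "f n"] n0[OF that] by simp
    qed
    then show "\<exists>n0. \<forall>n\<ge>n0. norm (f n - 0) < \<epsilon>" by auto
  qed
qed

text \<open>
  If \<open>w\<close> lies below \<open>(d\<^sub>i - \<delta> x)\<^sup>+\<close> for all \<open>i\<close> in a finite set \<open>S\<close>, then \<open>w\<^sup>+\<close> is disjoint from the
  opposite parts \<open>(\<delta> x - d\<^sub>i)\<^sup>+\<close>. Their sum is at least \<open>card S \<cdot> \<delta> x - x\<close>, hence at least \<open>x\<close> once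
  \<open>card S \<cdot> \<delta> \<ge> 2\<close>, which forces \<open>w\<^sup>+ = 0\<close>. So \<open>finite_multiplicity_null\<close> applies to \<open>(d\<^sub>n - \<delta> x)\<^sup>+\<close>,
  and \<open>d\<^sub>n\<close> exceeds this by at most \<open>\<delta> x\<close>.
\<close>

lemma bounded_partial_sums_null:
  fixes x :: "'f::banach_lattice" and d :: "nat \<Rightarrow> 'f"
  assumes dn: "\<And>v. disjoint_seq v \<Longrightarrow> (\<And>n. 0 \<le> v n) \<Longrightarrow> (\<And>n. v n \<le> x) \<Longrightarrow> v \<longlonglongrightarrow> 0"
    and d: "\<And>n. 0 \<le> d n" "\<And>n. (\<Sum>i<n. d i) \<le> x"
  shows "d \<longlonglongrightarrow> 0"
proof (rule LIMSEQ_I)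
  fix \<epsilon> :: real assume \<epsilon>: "0 < \<epsilon>"
  define \<delta> where "\<delta> = \<epsilon> / (2 * (norm x + 1))"
  have \<delta>: "0 < \<delta>" "\<delta> * norm x < \<epsilon> / 2"
  proof -
    have "0 < norm x + 1" by (simp add: add_nonneg_pos)
    then show "0 < \<delta>" "\<delta> * norm x < \<epsilon> / 2" using \<epsilon> by (simp_all add: \<delta>_def field_simps)
  qed
  have x0: "0 \<le> x" using d(2)[of 0] by simp
  define f where "f n = pprt (d n - \<delta> *\<^sub>R x)" for n
  have f_le: "f n \<le> d n" for n
    unfolding f_def pprt_def using d(1) x0 \<delta> by (auto intro: scaleR_nonneg_nonneg)
  have d_le: "d n \<le> x" for n
  proof -
    have "d n \<le> (\<Sum>i<Suc n. d i)" using sum_nonneg[of "{..<n}" d] d(1) by simp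
    then show ?thesis using d(2) by (rule order_trans)
  qed
  obtain N :: nat where N: "2 / \<delta> < real N" using reals_Archimedean2 by blast
  have "f \<longlonglongrightarrow> 0"
  proof (rule finite_multiplicity_null[OF dn])
    show "0 \<le> f n" for n by (simp add: f_def)
    show "f n \<le> x" for n using f_le d_le by (rule order_trans)
    fix S w assume S: "finite S" "card S = Suc N" "\<And>i. i \<in> S \<Longrightarrow> w \<le> f i"
    define c where "c i = pprt (- (d i - \<delta> *\<^sub>R x))" for i
    have wf: "pprt w \<le> f i" if "i \<in> S" for i
      using S(3)[OF that] by (simp add: f_def pprt_def)
    have disj: "inf (pprt w) (\<Sum>i\<in>S. c i) = 0"
    proof (rule disjoint_sum)
      fix i assume "i \<in> S"
      show "inf (pprt w) (c i) = 0"
        by (rule disjoint_mono[OF disjoint_pprt _ _ wf[OF \<open>i \<in> S\<close>, unfolded f_def]])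
          (auto simp: c_def)
    qed (auto simp: c_def S)
    have "x \<le> (\<Sum>i\<in>S. c i)"
    proof -
      obtain m where m: "S \<subseteq> {..<m}" using S(1) finite_nat_iff_bounded by auto
      have "(\<Sum>i\<in>S. d i) \<le> (\<Sum>i<m. d i)" using m d(1) by (intro sum_mono2) auto
      then have *: "(\<Sum>i\<in>S. d i) \<le> x" using d(2) by (rule order_trans)
      have "2 *\<^sub>R x \<le> (real (Suc N) * \<delta>) *\<^sub>R x"
        using N \<delta> x0 by (intro scaleR_right_mono) (auto simp: field_simps)
      then have "2 *\<^sub>R x - x \<le> (real (Suc N) * \<delta>) *\<^sub>R x - (\<Sum>i\<in>S. d i)"
        using * by (rule diff_mono)
      also have "\<dots> = (\<Sum>i\<in>S. - (d i - \<delta> *\<^sub>R x))"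
        using S(2) by (simp add: sum_subtractf scaleR_sum_left[symmetric] sum_constant_scaleR del: of_nat_Suc)
      also have "\<dots> \<le> (\<Sum>i\<in>S. c i)" unfolding c_def by (intro sum_mono le_pprt)
      finally show ?thesis by (simp add: scaleR_2)
    qed
    then have "inf (pprt w) x = 0"
      by (rule disjoint_mono[OF disj zero_le_pprt x0 order_refl])
    moreover have "pprt w \<le> x"
    proof -
      obtain i where "i \<in> S" using S(2) by fastforce
      then show ?thesis by (rule order_trans[OF wf order_trans[OF f_le d_le]])
    qed
    ultimately have "pprt w = 0" by (simp add: inf_absorb1)
    then show "w \<le> 0" using le_pprt[of w] by simp
  qed
  from LIMSEQ_D[OF this, of "\<epsilon> / 2"] \<epsilon> obtain n0
    where n0: "\<And>n. n \<ge> n0 \<Longrightarrow> norm (f n) < \<epsilon> / 2" by auto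
  have "norm (d n) < \<epsilon>" if "n \<ge> n0" for n
  proof -
    have "d n \<le> f n + \<delta> *\<^sub>R x" using le_pprt[of "d n - \<delta> *\<^sub>R x"] by (simp add: f_def algebra_simps)
    then have "norm (d n) \<le> norm (f n + \<delta> *\<^sub>R x)" by (intro norm_mono_nonneg d(1))
    also have "\<dots> \<le> norm (f n) + \<delta> * norm x"
      using norm_triangle_ineq[of "f n" "\<delta> *\<^sub>R x"] \<delta>(1) by simp
    finally show ?thesis using n0[OF that] \<delta>(2) by linarith
  qed
  then show "\<exists>n0. \<forall>n\<ge>n0. norm (d n - 0) < \<epsilon>" by auto
qed

text \<open>
  A net that is not norm Cauchy has infinitely many successive decrements bounded away from \<open>0\<close>, whose
  partial sums are below the first term. The limit of a norm Cauchy decreasing net is a lower bound,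
  hence at most the infimum \<open>0\<close>.
\<close>

lemma order_continuous_normI:
  assumes dn: "\<And>(v :: nat \<Rightarrow> 'f::banach_lattice) x. disjoint_seq v \<Longrightarrow> (\<And>n. 0 \<le> v n) \<Longrightarrow> (\<And>n. v n \<le> x) \<Longrightarrow> v \<longlonglongrightarrow> 0"
  shows "order_continuous_norm TYPE('f)"
  unfolding order_continuous_norm_def
proof (intro allI impI, elim conjE)
  fix I :: "'f set" and r and x :: "'f \<Rightarrow> 'f"
  assume dir: "directed_index I r" and dec: "net_decreases_to I r x 0"
  have mono: "x j \<le> x i" if "i \<in> I" "j \<in> I" "r i j" for i j
    using dec that unfolding net_decreases_to_def by blast
  have nonneg: "0 \<le> x i" if "i \<in> I" for i using dec that unfolding net_decreases_to_def by blast
  have glb: "z \<le> 0" if "\<And>i. i \<in> I \<Longrightarrow> z \<le> x i" for z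
    using dec that unfolding net_decreases_to_def by blast
  have cauchy: "\<exists>i\<in>I. \<forall>j\<in>I. r i j \<longrightarrow> norm (x i - x j) < \<epsilon>" if \<epsilon>: "0 < \<epsilon>" for \<epsilon>
  proof (rule ccontr)
    assume "\<not> ?thesis"
    then have step: "\<exists>j. j \<in> I \<and> r i j \<and> \<epsilon> \<le> norm (x i - x j)" if "i \<in> I" for i
      using that by (meson not_less)
    have "\<exists>i. \<forall>n::nat. i n \<in> I \<and> (r (i n) (i (Suc n)) \<and> \<epsilon> \<le> norm (x (i n) - x (i (Suc n))))"
    proof (rule dependent_nat_choice)
      show "\<exists>i. i \<in> I" using dir unfolding directed_index_def by blast
    next
      fix i and n :: nat assume "i \<in> I"
      then show "\<exists>j. j \<in> I \<and> r i j \<and> \<epsilon> \<le> norm (x i - x j)" by (rule step)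
    qed
    then obtain i where i: "\<And>n. i n \<in> I" "\<And>n. r (i n) (i (Suc n))"
        "\<And>n. \<epsilon> \<le> norm (x (i n) - x (i (Suc n)))"
      by blast
    have "(\<lambda>n. x (i n) - x (i (Suc n))) \<longlonglongrightarrow> 0"
    proof (rule bounded_partial_sums_null[of "x (i 0)"])
      show "0 \<le> x (i n) - x (i (Suc n))" for n using mono[OF i(1) i(1) i(2)] by simp
      have "(\<Sum>k<n. x (i k) - x (i (Suc k))) = x (i 0) - x (i n)" for n
        by (rule sum_lessThan_telescope')
      then show "(\<Sum>k<n. x (i k) - x (i (Suc k))) \<le> x (i 0)" for n
        using nonneg[OF i(1)] by simp
    qed (rule dn)
    from LIMSEQ_D[OF this \<epsilon>] i(3) show False by (auto simp: not_less[symmetric])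
  qed
  have "\<exists>i. i \<in> I \<and> (\<forall>j\<in>I. r i j \<longrightarrow> norm (x i - x j) < 1 / real (Suc n))" for n
    using cauchy[of "1 / real (Suc n)"] by auto
  then obtain i where i: "\<And>n. i n \<in> I"
      "\<And>n j. j \<in> I \<Longrightarrow> r (i n) j \<Longrightarrow> norm (x (i n) - x j) < 1 / real (Suc n)"
    by metis
  have common: "\<exists>k\<in>I. r a k \<and> r b k" if "a \<in> I" "b \<in> I" for a b
    using dir that unfolding directed_index_def by blast
  have close: "norm (x (i m) - x (i n)) < 1 / real (Suc m) + 1 / real (Suc n)" for m n
  proof -
    obtain k where k: "k \<in> I" "r (i m) k" "r (i n) k" using common[OF i(1) i(1)] by blast
    have "norm (x (i m) - x (i n)) \<le> norm (x (i m) - x k) + norm (x (i n) - x k)"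
      using norm_triangle_ineq4[of "x (i m) - x k" "x (i n) - x k"] by simp
    with i(2)[OF k(1,2)] i(2)[OF k(1,3)] show ?thesis by linarith
  qed
  have "Cauchy (\<lambda>n. x (i n))"
  proof (rule CauchyI)
    fix \<epsilon> :: real assume "0 < \<epsilon>"
    then obtain N where N: "2 / \<epsilon> < real N" using reals_Archimedean2 by blast
    have "norm (x (i m) - x (i n)) < \<epsilon>" if "m \<ge> N" "n \<ge> N" for m n
    proof -
      have half: "1 / real (Suc m) \<le> \<epsilon> / 2" if "m \<ge> N" for m
      proof -
        have "2 / \<epsilon> \<le> real (Suc m)" using N that by linarith
        then show ?thesis using \<open>0 < \<epsilon>\<close> by (simp add: field_simps)
      qed
      show ?thesis using close[of m n] half[OF that(1)] half[OF that(2)] by linarith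
    qed
    then show "\<exists>M. \<forall>m\<ge>M. \<forall>n\<ge>M. norm (x (i m) - x (i n)) < \<epsilon>" by blast
  qed
  then obtain l where l: "(\<lambda>n. x (i n)) \<longlonglongrightarrow> l"
    using Cauchy_convergent_iff convergent_def by blast
  have "l \<le> x j" if j: "j \<in> I" for j
  proof -
    have "norm (pprt (x (i n) - x j)) \<le> 1 / real (Suc n)" for n
    proof -
      obtain k where k: "k \<in> I" "r (i n) k" "r j k" using common[OF i(1) j] by blast
      have "x (i n) - x j \<le> x (i n) - x k" using mono[OF j k(1,3)] by simp
      moreover have "0 \<le> x (i n) - x k" using mono[OF i(1) k(1,2)] by simp
      ultimately have "pprt (x (i n) - x j) \<le> x (i n) - x k" by (simp add: pprt_def)
      from norm_mono_nonneg[OF zero_le_pprt this] i(2)[OF k(1,2)] show ?thesis by linarith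
    qed
    then have "(\<lambda>n. pprt (x (i n) - x j)) \<longlonglongrightarrow> 0"
      by (intro Lim_null_comparison[OF _ LIMSEQ_Suc[OF lim_1_over_n]]) auto
    then have "(\<lambda>n. pprt (x (i n) - x j) - (x (i n) - x j)) \<longlonglongrightarrow> 0 - (l - x j)"
      using l by (intro tendsto_intros)
    then have "0 \<le> 0 - (l - x j)"
      by (rule nonneg_LIMSEQ) (simp add: le_pprt)
    then show ?thesis by simp
  qed
  then have "l \<le> 0" by (rule glb)
  moreover have "0 \<le> l" by (rule nonneg_LIMSEQ[OF l nonneg[OF i(1)]])
  ultimately have "l = 0" by simp
  with l have lim: "(\<lambda>n. norm (x (i n))) \<longlonglongrightarrow> 0" by (simp add: tendsto_norm_zero)
  show "net_decreases_to I r (\<lambda>i. norm (x i)) 0"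
    unfolding net_decreases_to_def
  proof (intro conjI ballI impI allI)
    fix z assume "\<forall>i\<in>I. z \<le> norm (x i)"
    then have "z \<le> norm (x (i n))" for n using i(1) by blast
    then show "z \<le> 0" using LIMSEQ_le_const[OF lim] by blast
  qed (use mono nonneg in \<open>auto intro: norm_mono_nonneg\<close>)
qed

section \<open>The characterisation\<close>

text \<open>
  For \<open>\<bar>y\<^sub>n\<bar> \<le> \<bar>T a\<^sub>n\<bar> \<le> T \<bar>a\<^sub>n\<bar>\<close>, the part of \<open>\<bar>y\<^sub>n\<bar>\<close> above \<open>T u\<close> is dominated by \<open>T((\<bar>a\<^sub>n\<bar> - u)\<^sup>+)\<close>, which
  is uniformly small, and the parts below \<open>T u\<close> form an order bounded disjoint sequence.
\<close>

lemma positive_almost_DP_imp_almost_L_weakly_compact: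
  fixes T :: "'e::banach_lattice \<Rightarrow> 'f::banach_lattice"
  assumes oc: "order_continuous_norm TYPE('f)"
    and pos: "positive_operator T" and DP: "almost_Dunford_Pettis T"
  shows "almost_L_weakly_compact T"
  unfolding almost_L_weakly_compact_def
proof (intro conjI allI impI, goal_cases)
  show T: "bounded_linear T" using pos by (simp add: positive_operator_def)
  case (2 A)
  then have A: "A \<noteq> {}" "relatively_weakly_compact A" by auto
  have bdd: "bounded A" using A(2) by (rule relatively_weakly_compact_imp_bounded)
  have lin: "linear T" using T by (rule bounded_linear.linear)
  have T_mono: "T a \<le> T b" if "a \<le> b" for a b
  proof -
    have "0 \<le> T (b - a)" using pos that by (simp add: positive_operator_def)
    then show ?thesis by (simp add: linear_diff[OF lin])
  qed
  have T_abs: "\<bar>T a\<bar> \<le> T \<bar>a\<bar>" for a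
  proof (rule abs_leI)
    show "T a \<le> T \<bar>a\<bar>" by (intro T_mono abs_ge_self)
    have "T (- a) \<le> T \<bar>a\<bar>" by (intro T_mono abs_ge_minus_self)
    then show "- T a \<le> T \<bar>a\<bar>" by (simp add: linear_neg[OF lin])
  qed
  show "L_weakly_compact (T ` A)"
    unfolding L_weakly_compact_def
  proof (intro conjI allI impI)
    show "T ` A \<noteq> {}" using A(1) by simp
    show "bounded (T ` A)" using bdd T by (rule bounded_linear_image)
    fix y assume y: "disjoint_seq y \<and> range y \<subseteq> solid_hull (T ` A)"
    have "\<exists>a\<in>A. \<bar>y n\<bar> \<le> \<bar>T a\<bar>" for n
    proof -
      have "y n \<in> solid_hull (T ` A)" using y by blast
      then show ?thesis by (auto simp: solid_hull_def)
    qed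
    then obtain a where a: "\<And>n. a n \<in> A" "\<And>n. \<bar>y n\<bar> \<le> \<bar>T (a n)\<bar>" by metis
    show "(\<lambda>n. norm (y n)) \<longlonglongrightarrow> 0"
    proof (rule LIMSEQ_I)
      fix \<epsilon> :: real assume \<epsilon>: "0 < \<epsilon>"
      obtain S K where S: "finite S" "S \<subseteq> abs ` A" "0 \<le> K"
        "\<And>b. b \<in> abs ` A \<Longrightarrow> norm (T (pprt (b - K *\<^sub>R \<Sum>S))) < \<epsilon> / 2"
      proof (rule approximate_order_bound[OF T, of "abs ` A" "\<epsilon> / 2"])
        show "bounded (abs ` A)" using bdd by (auto simp: bounded_iff norm_abs)
        fix u assume u: "disjoint_seq u" "\<And>n. 0 \<le> u n" "\<And>n. \<exists>b\<in>abs ` A. u n \<le> b"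
        have "weakly_null u"
          using u(2,3) by (intro disjoint_seq_weakly_null[OF A(2) u(1)]) auto
        then show "(\<lambda>n. T (u n)) \<longlonglongrightarrow> 0"
          using DP u(1) unfolding almost_Dunford_Pettis_def by (simp add: tendsto_norm_zero_iff)
      qed (use \<epsilon> in auto)
      define u where "u = K *\<^sub>R \<Sum>S"
      have u0: "0 \<le> u" unfolding u_def using S by (intro scaleR_nonneg_nonneg sum_nonneg) auto
      have Tu0: "0 \<le> T u" using pos u0 by (simp add: positive_operator_def)
      have "(\<lambda>n. inf \<bar>y n\<bar> (T u)) \<longlonglongrightarrow> 0"
      proof (rule order_continuous_norm_imp_disjoint_null[OF oc, of _ "T u"])
        show "disjoint_seq (\<lambda>n. inf \<bar>y n\<bar> (T u))"
          unfolding disjoint_seq_def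
        proof (intro allI impI)
          fix m n :: nat assume "m \<noteq> n"
          then have "inf \<bar>y m\<bar> \<bar>y n\<bar> = 0" using y by (simp add: disjoint_seq_def)
          then have "inf (inf \<bar>y m\<bar> (T u)) (inf \<bar>y n\<bar> (T u)) = 0"
            by (rule disjoint_mono) (use Tu0 in auto)
          then show "inf (abs (inf \<bar>y m\<bar> (T u))) (abs (inf \<bar>y n\<bar> (T u))) = 0"
            using Tu0 by (simp add: abs_of_nonneg)
        qed
      qed (use Tu0 in auto)
      from LIMSEQ_D[OF this, of "\<epsilon> / 2"] \<epsilon> obtain n0
        where n0: "\<And>n. n \<ge> n0 \<Longrightarrow> norm (inf \<bar>y n\<bar> (T u)) < \<epsilon> / 2" by auto
      have "norm (y n) < \<epsilon>" if "n \<ge> n0" for n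
      proof -
        have "\<bar>y n\<bar> \<le> T \<bar>a n\<bar>" using a(2) T_abs by (rule order_trans)
        also have "\<dots> \<le> T (u + pprt (\<bar>a n\<bar> - u))"
          using le_pprt[of "\<bar>a n\<bar> - u"] by (intro T_mono) (simp add: algebra_simps)
        also have "\<dots> = T u + T (pprt (\<bar>a n\<bar> - u))" by (rule linear_add[OF lin])
        finally have "\<bar>y n\<bar> - T u \<le> T (pprt (\<bar>a n\<bar> - u))" by (simp add: algebra_simps)
        moreover have "0 \<le> T (pprt (\<bar>a n\<bar> - u))" using pos by (simp add: positive_operator_def)
        ultimately have "pprt (\<bar>y n\<bar> - T u) \<le> T (pprt (\<bar>a n\<bar> - u))" by (simp add: pprt_def)
        then have "norm (pprt (\<bar>y n\<bar> - T u)) \<le> norm (T (pprt (\<bar>a n\<bar> - u)))"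
          by (intro norm_mono_nonneg) auto
        moreover have "norm (T (pprt (\<bar>a n\<bar> - u))) < \<epsilon> / 2"
          unfolding u_def using a(1) by (intro S(4)) auto
        moreover have "\<bar>y n\<bar> = pprt (\<bar>y n\<bar> - T u) + inf \<bar>y n\<bar> (T u)"
          by (rule pprt_diff_add_inf[symmetric])
        then have "norm (y n) \<le> norm (pprt (\<bar>y n\<bar> - T u)) + norm (inf \<bar>y n\<bar> (T u))"
          by (metis norm_abs norm_triangle_ineq)
        ultimately show ?thesis using n0[OF that] by linarith
      qed
      then show "\<exists>n0. \<forall>n\<ge>n0. norm (norm (y n) - 0) < \<epsilon>" by auto
    qed
  qed
qed

theorem proposition2p8:
  assumes "\<exists>x :: 'e::banach_lattice. x \<noteq> 0"
    and "\<exists>y :: 'f::banach_lattice. y \<noteq> 0"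
  shows "(\<forall>T :: 'e \<Rightarrow> 'f. positive_operator T \<and> almost_Dunford_Pettis T
            \<longrightarrow> almost_L_weakly_compact T)
         \<longleftrightarrow> order_continuous_norm TYPE('f)"
proof
  assume ops: "\<forall>T :: 'e \<Rightarrow> 'f. positive_operator T \<and> almost_Dunford_Pettis T
    \<longrightarrow> almost_L_weakly_compact T"
  obtain x0 :: 'e where x0: "0 \<le> x0" "x0 \<noteq> 0"
    using assms(1) by (metis abs_ge_zero abs_eq_0)
  obtain \<phi> :: "'e \<Rightarrow> real"
    where \<phi>: "bounded_linear \<phi>" "\<And>x. 0 \<le> x \<Longrightarrow> 0 \<le> \<phi> x" "\<phi> x0 = norm x0"
    using positive_functional[OF x0(1)] by blast
  show "order_continuous_norm TYPE('f)"
  proof (rule order_continuous_normI)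
    fix v :: "nat \<Rightarrow> 'f" and u
    assume v: "disjoint_seq v" "\<And>n. 0 \<le> v n" "\<And>n. v n \<le> u"
    have u0: "0 \<le> u" using order_trans[OF v(2) v(3)] .
    \<comment> \<open>Scaled so that \<open>T x0 = u\<close>.\<close>
    define T :: "'e \<Rightarrow> 'f" where "T x = (\<phi> x / norm x0) *\<^sub>R u" for x
    have T: "bounded_linear T"
      unfolding T_def
      by (intro bounded_linear_scaleR_const bounded_linear_divide[THEN bounded_linear_compose] \<phi>(1))
    have "positive_operator T"
      using T \<phi>(2) u0 by (auto simp: positive_operator_def T_def intro!: scaleR_nonneg_nonneg)
    moreover have "almost_Dunford_Pettis T"
      unfolding almost_Dunford_Pettis_def
    proof (intro conjI allI impI T)
      fix x :: "nat \<Rightarrow> 'e" assume "disjoint_seq x \<and> weakly_null x"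
      then have "(\<lambda>n. \<phi> (x n)) \<longlonglongrightarrow> 0" using \<phi>(1) by (simp add: weakly_null_def)
      then have "(\<lambda>n. (\<phi> (x n) / norm x0) *\<^sub>R u) \<longlonglongrightarrow> (0 / norm x0) *\<^sub>R u"
        by (intro tendsto_intros) (use x0 in auto)
      then have "(\<lambda>n. T (x n)) \<longlonglongrightarrow> 0" by (simp add: T_def)
      then show "(\<lambda>n. norm (T (x n))) \<longlonglongrightarrow> 0" by (rule tendsto_norm_zero)
    qed
    ultimately have "L_weakly_compact (T ` {x0})"
      using ops relatively_weakly_compact_singleton[of x0]
      unfolding almost_L_weakly_compact_def by blast
    moreover have "T x0 = u" using x0 by (simp add: T_def \<phi>(3))
    moreover have "range v \<subseteq> solid_hull {u}" using v(2,3) u0 by (auto simp: solid_hull_def)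
    ultimately have "(\<lambda>n. norm (v n)) \<longlonglongrightarrow> 0"
      using v(1) unfolding L_weakly_compact_def by simp
    then show "v \<longlonglongrightarrow> 0" by (rule tendsto_norm_zero_cancel)
  qed
next
  assume "order_continuous_norm TYPE('f)"
  then show "\<forall>T :: 'e \<Rightarrow> 'f. positive_operator T \<and> almost_Dunford_Pettis T
      \<longrightarrow> almost_L_weakly_compact T"
    using positive_almost_DP_imp_almost_L_weakly_compact by blast
qed

end
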